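(* Let $G$ be a finite group of order $n$ with a fixed listing $g_1,\dots,g_n$ of its elements, and let $\{e_1,\dots,e_k\}$ be the complete orthogonal set of primitive central idempotents of $\mathbb{C}G$ (so $k$ is the number of conjugacy classes of $G$). Let $r_i=\operatorname{rank}\sigma(e_i)$ for $i=1,\dots,k$. Then there exists a non-singular matrix $P\in\mathbb{C}^{n\times n}$ such that for every $\mathbb{C}G$-matrix $A$ one has $P^{-1}AP=T$, where $T=\operatorname{diag}(T_1,T_2,\dots,T_k)$ is a block diagonal matrix (depending on $A$) whose $i$-th diagonal block $T_i$ has size $r_i\times r_i$. In particular $P$ does not depend on $A$.
   Context: For a finite group $G$ with a fixed listing $g_1,\dots,g_n$ of its elements and $w=\sum_{g\in G}\alpha_g g\in\mathbb{C}G$, let $\sigma(w)$ be the $n\times n$ complex matrix whose $(i,j)$ entry is $\alpha_{g_i^{-1}g_j}$. A $\mathbb{C}G$-matrix (group ring matrix), relative to the listing, is a matrix of the form $\sigma(w)$ with $w\in\mathbb{C}G$. A complete orthogonal set of idempotents in a ring with identity $1$ is a set $\{e_1,\dots,e_k\}$ with $e_i^2=e_i$, $e_ie_j=0$ for $i\ne j$, and $e_1+\dots+e_k=1$. *)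

theory Defs
  imports "HOL-Algebra.Group_Action" "Jordan_Normal_Form.Matrix" "Jordan_Normal_Form.DL_Rank"
begin

text \<open>
  An element \<open>\<Sum>x\<in>G. \<alpha>\<^sub>x x\<close> is represented by its coefficient function \<open>x \<mapsto> \<alpha>\<^sub>x\<close>, which is
  required to vanish outside the carrier of the group, so that equality of elements is equality of
  functions. This is the full group ring only if the group is finite (no finite-support condition
  is imposed).
\<close>

definition group_ring :: "('a, 'b) monoid_scheme \<Rightarrow> ('a \<Rightarrow> complex) ring" where
  "group_ring G =
     \<lparr> carrier = {w. \<forall>x. x \<notin> carrier G \<longrightarrow> w x = 0},
       mult = (\<lambda>u v x. \<Sum>(y, z) | y \<in> carrier G \<and> z \<in> carrier G \<and> y \<otimes>\<^bsub>G\<^esub> z = x. u y * v z),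
       one = (\<lambda>x. if x = \<one>\<^bsub>G\<^esub> then 1 else 0),
       zero = (\<lambda>x. 0),
       add = (\<lambda>u v x. u x + v x) \<rparr>"

lemma (in group) group_ring_mult_eq:
  assumes "finite (carrier G)" and "x \<in> carrier G"
  shows "(u \<otimes>\<^bsub>group_ring G\<^esub> v) x = (\<Sum>y\<in>carrier G. u y * v (inv y \<otimes> x))"
proof -
  have "(\<Sum>(y, z) | y \<in> carrier G \<and> z \<in> carrier G \<and> y \<otimes> z = x. u y * v z)
      = (\<Sum>y\<in>carrier G. u y * v (inv y \<otimes> x))"
    by (rule sum.reindex_bij_witness[of _ "\<lambda>y. (y, inv y \<otimes> x)" fst])
       (use assms in \<open>auto simp: m_assoc[symmetric]\<close>)
  then show ?thesis by (simp add: group_ring_def)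
qed

lemma (in group) group_ring_mult_outside:
  assumes "x \<notin> carrier G"
  shows "(u \<otimes>\<^bsub>group_ring G\<^esub> v) x = 0"
proof -
  have "{(y, z). y \<in> carrier G \<and> z \<in> carrier G \<and> y \<otimes> z = x} = {}"
    using assms by auto
  then show ?thesis by (simp only: group_ring_def monoid.simps sum.empty)
qed

lemma (in group) ring_group_ring:
  assumes fin: "finite (carrier G)"
  shows "ring (group_ring G)"
proof (rule ringI)
  let ?R = "group_ring G"
  show "abelian_group ?R"
  proof (rule abelian_groupI)
    fix u assume "u \<in> carrier ?R"
    then show "\<exists>v\<in>carrier ?R. v \<oplus>\<^bsub>?R\<^esub> u = \<zero>\<^bsub>?R\<^esub>"
      by (intro bexI[of _ "\<lambda>x. - u x"]) (auto simp: group_ring_def)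
  qed (auto simp: group_ring_def)
  have mult_closed: "u \<otimes>\<^bsub>?R\<^esub> v \<in> carrier ?R" for u v
    using group_ring_mult_outside by (simp add: group_ring_def)
  have ext: "u = v" if "u \<in> carrier ?R" "v \<in> carrier ?R" "\<And>x. x \<in> carrier G \<Longrightarrow> u x = v x" for u v
    using that unfolding group_ring_def by (intro HOL.ext) (simp, metis)
  have add_closed: "u \<oplus>\<^bsub>?R\<^esub> v \<in> carrier ?R" if "u \<in> carrier ?R" "v \<in> carrier ?R" for u v
    using that by (auto simp: group_ring_def)
  have add_app: "(u \<oplus>\<^bsub>?R\<^esub> v) x = u x + v x" for u v x
    by (simp add: group_ring_def)
  have one_app: "\<one>\<^bsub>?R\<^esub> x = (if x = \<one> then 1 else 0)" for x
    by (simp add: group_ring_def)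
  have one_closed: "\<one>\<^bsub>?R\<^esub> \<in> carrier ?R"
    by (auto simp: group_ring_def)
  show "monoid ?R"
  proof (rule monoidI)
    show "\<one>\<^bsub>?R\<^esub> \<in> carrier ?R" by (rule one_closed)
    show "u \<otimes>\<^bsub>?R\<^esub> v \<in> carrier ?R" for u v by (rule mult_closed)
    fix u v w
    assume u: "u \<in> carrier ?R"
    show "\<one>\<^bsub>?R\<^esub> \<otimes>\<^bsub>?R\<^esub> u = u"
    proof (rule ext[OF mult_closed u])
      fix x assume x: "x \<in> carrier G"
      have "(\<one>\<^bsub>?R\<^esub> \<otimes>\<^bsub>?R\<^esub> u) x = (\<Sum>y\<in>carrier G. if y = \<one> then u (inv y \<otimes> x) else 0)"
        unfolding group_ring_mult_eq[OF fin x] by (intro sum.cong) (auto simp: one_app)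
      then show "(\<one>\<^bsub>?R\<^esub> \<otimes>\<^bsub>?R\<^esub> u) x = u x" using fin x by simp
    qed
    show "u \<otimes>\<^bsub>?R\<^esub> \<one>\<^bsub>?R\<^esub> = u"
    proof (rule ext[OF mult_closed u])
      fix x assume x: "x \<in> carrier G"
      have "inv y \<otimes> x = \<one> \<longleftrightarrow> y = x" if "y \<in> carrier G" for y
        using that x by (metis inv_closed inv_equality inv_inv l_inv)
      then have "(u \<otimes>\<^bsub>?R\<^esub> \<one>\<^bsub>?R\<^esub>) x = (\<Sum>y\<in>carrier G. if y = x then u y else 0)"
        unfolding group_ring_mult_eq[OF fin x] by (intro sum.cong) (auto simp: one_app)
      then show "(u \<otimes>\<^bsub>?R\<^esub> \<one>\<^bsub>?R\<^esub>) x = u x" using fin x by simp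
    qed
    show "u \<otimes>\<^bsub>?R\<^esub> v \<otimes>\<^bsub>?R\<^esub> w = u \<otimes>\<^bsub>?R\<^esub> (v \<otimes>\<^bsub>?R\<^esub> w)"
    proof (rule ext[OF mult_closed mult_closed])
      fix x assume x: "x \<in> carrier G"
      have cancel: "inv (inv z \<otimes> y) \<otimes> (inv z \<otimes> x) = inv y \<otimes> x"
        if "y \<in> carrier G" "z \<in> carrier G" for y z
        using that x by (metis inv_closed inv_mult_group inv_inv m_assoc m_closed r_inv l_one)
      have shift: "(\<Sum>y\<in>carrier G. v (inv z \<otimes> y) * w (inv y \<otimes> x))
          = (\<Sum>y\<in>carrier G. v y * w (inv y \<otimes> (inv z \<otimes> x)))" if z: "z \<in> carrier G" for z
        by (rule sum.reindex_bij_witness[of _ "\<lambda>y. z \<otimes> y" "\<lambda>y. inv z \<otimes> y"])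
           (use x z in \<open>simp_all add: cancel flip: m_assoc[of z] m_assoc[of "inv z" z]\<close>)
      have "(u \<otimes>\<^bsub>?R\<^esub> v \<otimes>\<^bsub>?R\<^esub> w) x
          = (\<Sum>y\<in>carrier G. \<Sum>z\<in>carrier G. u z * v (inv z \<otimes> y) * w (inv y \<otimes> x))"
        using fin x by (simp add: group_ring_mult_eq sum_distrib_right)
      also have "\<dots> = (\<Sum>z\<in>carrier G. u z * (\<Sum>y\<in>carrier G. v (inv z \<otimes> y) * w (inv y \<otimes> x)))"
        by (subst sum.swap) (simp add: sum_distrib_left mult.assoc)
      also have "\<dots> = (u \<otimes>\<^bsub>?R\<^esub> (v \<otimes>\<^bsub>?R\<^esub> w)) x"
        using fin x by (simp add: group_ring_mult_eq shift)
      finally show "(u \<otimes>\<^bsub>?R\<^esub> v \<otimes>\<^bsub>?R\<^esub> w) x = (u \<otimes>\<^bsub>?R\<^esub> (v \<otimes>\<^bsub>?R\<^esub> w)) x" .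
    qed
  qed
  fix u v w
  assume c: "u \<in> carrier ?R" "v \<in> carrier ?R"
  show "(u \<oplus>\<^bsub>?R\<^esub> v) \<otimes>\<^bsub>?R\<^esub> w = u \<otimes>\<^bsub>?R\<^esub> w \<oplus>\<^bsub>?R\<^esub> v \<otimes>\<^bsub>?R\<^esub> w"
    by (rule ext[OF mult_closed add_closed[OF mult_closed mult_closed]])
       (simp add: group_ring_mult_eq fin add_app distrib_right sum.distrib)
  show "w \<otimes>\<^bsub>?R\<^esub> (u \<oplus>\<^bsub>?R\<^esub> v) = w \<otimes>\<^bsub>?R\<^esub> u \<oplus>\<^bsub>?R\<^esub> w \<otimes>\<^bsub>?R\<^esub> v"
    by (rule ext[OF mult_closed add_closed[OF mult_closed mult_closed]])
       (simp add: group_ring_mult_eq fin add_app distrib_left sum.distrib)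
qed

definition complete_orthogonal_idempotents :: "('a, 'm) ring_scheme \<Rightarrow> 'a set \<Rightarrow> bool" where
  "complete_orthogonal_idempotents R E \<longleftrightarrow>
     finite E \<and> E \<subseteq> carrier R \<and>
     (\<forall>e\<in>E. e \<otimes>\<^bsub>R\<^esub> e = e) \<and>
     (\<forall>e\<in>E. \<forall>f\<in>E. e \<noteq> f \<longrightarrow> e \<otimes>\<^bsub>R\<^esub> f = \<zero>\<^bsub>R\<^esub>) \<and>
     (\<Oplus>\<^bsub>R\<^esub>e\<in>E. e) = \<one>\<^bsub>R\<^esub>"

definition central_idempotents :: "('a, 'm) ring_scheme \<Rightarrow> 'a set" where
  "central_idempotents R =
     {e \<in> carrier R. e \<otimes>\<^bsub>R\<^esub> e = e \<and> (\<forall>x\<in>carrier R. e \<otimes>\<^bsub>R\<^esub> x = x \<otimes>\<^bsub>R\<^esub> e)}"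

text \<open>
  Primitivity refers to decompositions within the central idempotents; such an element need not be
  a primitive idempotent of the (non-commutative) ring.
\<close>

definition primitive_central_idempotents :: "('a, 'm) ring_scheme \<Rightarrow> 'a set" where
  "primitive_central_idempotents R =
     {e \<in> central_idempotents R. e \<noteq> \<zero>\<^bsub>R\<^esub> \<and>
        \<not> (\<exists>f\<in>central_idempotents R. \<exists>h\<in>central_idempotents R.
             f \<noteq> \<zero>\<^bsub>R\<^esub> \<and> h \<noteq> \<zero>\<^bsub>R\<^esub> \<and> f \<otimes>\<^bsub>R\<^esub> h = \<zero>\<^bsub>R\<^esub> \<and> e = f \<oplus>\<^bsub>R\<^esub> h)}"

definition conjugacy_classes :: "('a, 'b) monoid_scheme \<Rightarrow> 'a set set" where
  "conjugacy_classes G =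
     orbits G (carrier G) (\<lambda>g. \<lambda>h\<in>carrier G. g \<otimes>\<^bsub>G\<^esub> h \<otimes>\<^bsub>G\<^esub> inv\<^bsub>G\<^esub> g)"

text \<open>
  A listing of a group of order \<open>n\<close> is a bijection \<open>g\<close> from \<open>{..<n}\<close> onto the carrier: indices start
  at 0, as matrix indices do.
\<close>

definition group_ring_mat ::
  "('a, 'b) monoid_scheme \<Rightarrow> nat \<Rightarrow> (nat \<Rightarrow> 'a) \<Rightarrow> ('a \<Rightarrow> complex) \<Rightarrow> complex mat" where
  "group_ring_mat G n g w = mat n n (\<lambda>(i, j). w (inv\<^bsub>G\<^esub> (g i) \<otimes>\<^bsub>G\<^esub> g j))"

definition group_ring_matrices ::
  "('a, 'b) monoid_scheme \<Rightarrow> nat \<Rightarrow> (nat \<Rightarrow> 'a) \<Rightarrow> complex mat set" where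
  "group_ring_matrices G n g = group_ring_mat G n g ` carrier (group_ring G)"

end

theory Submission
  imports Defs "Jordan_Normal_Form.Spectral_Radius"
begin

text \<open>
  An idempotent matrix of rank \<open>r\<close> factors as \<open>E = U V\<close> with \<open>V U = 1\<close> of size \<open>r\<close>, so its trace is its
  rank. For pairwise orthogonal idempotents \<open>E\<^sub>i = U\<^sub>i V\<^sub>i\<close> with sum \<open>1\<close>, the matrices
  \<open>P = [U\<^sub>1 \<dots> U\<^sub>k]\<close> and \<open>Q = [V\<^sub>1; \<dots>; V\<^sub>k]\<close> are mutually inverse, and \<open>Q A P\<close> is block diagonal
  whenever \<open>A\<close> commutes with all \<open>E\<^sub>i\<close>, because \<open>V\<^sub>i A U\<^sub>j = V\<^sub>i A E\<^sub>i E\<^sub>j U\<^sub>j\<close>.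

  For the count of conjugacy classes, a central \<open>y\<close> has a normal matrix, hence the kernels of \<open>y\<close> and
  \<open>y\<^sup>2\<close> agree and \<open>y = w y\<^sup>2\<close> for some \<open>w\<close>; then \<open>w y\<close> is a central idempotent. Therefore a central
  element acts on the ideal of a primitive central idempotent as a scalar, and the primitive central
  idempotents form a basis of the centre, as do the class sums.
\<close>

subsection \<open>Rank factorization\<close>

lemma mat_mult_unit_vec:
  fixes A :: "'a::semiring_1 mat"
  assumes "A \<in> carrier_mat n m" "i < m"
  shows "A *\<^sub>v unit_vec m i = col A i"
  using assms by (intro eq_vecI) auto

text \<open>Column by column, the difference of \<open>X\<close> and \<open>Y\<close> lies in the
  kernel of \<open>U\<close>, which \<open>inj\<close> makes trivial.\<close>

lemma mat_left_cancel:
  fixes U :: "'a::comm_ring_1 mat"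
  assumes U: "U \<in> carrier_mat n r"
    and inj: "\<forall>v\<in>carrier_vec r. U *\<^sub>v v = 0\<^sub>v n \<longrightarrow> v = 0\<^sub>v r"
    and X: "X \<in> carrier_mat r m" and Y: "Y \<in> carrier_mat r m" and eq: "U * X = U * Y"
  shows "X = Y"
proof (rule mat_col_eqI)
  fix i assume "i < dim_col Y"
  then have i: "i < m" using Y by auto
  have c: "col X i \<in> carrier_vec r" "col Y i \<in> carrier_vec r" using X Y i by auto
  have "U *\<^sub>v col X i = U *\<^sub>v col Y i"
    using eq col_mult2[OF U X i] col_mult2[OF U Y i] by simp
  then have "U *\<^sub>v (col X i - col Y i) = 0\<^sub>v n"
    using U c by (simp add: mult_minus_distrib_mat_vec[of _ n r])
  then have z: "col X i - col Y i = 0\<^sub>v r" using c inj by auto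
  show "col X i = col Y i"
  proof (rule eq_vecI)
    fix j assume "j < dim_vec (col Y i)"
    then have j: "j < r" using Y by auto
    have "col X i $ j - col Y i $ j = (col X i - col Y i) $ j"
      using Y j by (intro index_minus_vec(1)[symmetric]) auto
    also have "\<dots> = 0" using z j by simp
    finally show "col X i $ j = col Y i $ j" by (simp only: right_minus_eq)
  qed (use X Y in auto)
qed (use X Y in auto)

text \<open>The columns of \<open>U\<close> are a maximal independent set of columns of
  \<open>A\<close>, \<open>V\<close> holds the coordinates of all columns of \<open>A\<close> in
  that basis, and \<open>S\<close> selects the basis columns, so \<open>A * S = U\<close>.
  Cancelling \<open>U\<close> in \<open>U * (V * S) = U\<close> makes \<open>S\<close> a right
  inverse of \<open>V\<close>.\<close>

lemma (in vec_space) rank_factorization: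
  assumes A: "A \<in> carrier_mat n m"
  obtains U V S where "U \<in> carrier_mat n (rank A)" "V \<in> carrier_mat (rank A) m" "S \<in> carrier_mat m (rank A)"
    "A = U * V" "V * S = 1\<^sub>m (rank A)" "\<forall>v\<in>carrier_vec (rank A). U *\<^sub>v v = 0\<^sub>v n \<longrightarrow> v = 0\<^sub>v (rank A)"
proof -
  have sub: "set (cols A) \<subseteq> carrier_vec n" using cols_dim A by blast
  have "lin_indpt {}" by (rule finite_lin_indpt2) auto
  then obtain B where B: "finite B" "maximal B (\<lambda>T. T \<subseteq> set (cols A) \<and> lin_indpt T)"
    using maximal_exists_superset[of "set (cols A)" "\<lambda>T. T \<subseteq> set (cols A) \<and> lin_indpt T" "{}"] by auto
  then have Bs: "B \<subseteq> set (cols A)" and Bi: "lin_indpt B" by (auto simp: maximal_def)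
  have Bc: "B \<subseteq> carrier_vec n" using Bs sub by blast
  define r where "r = rank A"
  have r: "card B = r" using rank_card_indpt[OF A B(2)] r_def by simp
  obtain bs where bs: "set bs = B" "distinct bs" using finite_distinct_list[OF B(1)] by blast
  have len: "length bs = r" using bs r distinct_card by fastforce
  define U where "U = mat_of_cols n bs"
  have U: "U \<in> carrier_mat n r" unfolding U_def using len by auto
  have colsU: "cols U = bs" unfolding U_def using Bc bs by (intro cols_mat_of_cols) auto
  \<comment> \<open>A nonzero kernel vector is a linear relation between the columns; as
    \<open>bs\<close> is distinct, it is a relation within the independent set
    \<open>B\<close>.\<close>
  have inj: "\<forall>v\<in>carrier_vec r. U *\<^sub>v v = 0\<^sub>v n \<longrightarrow> v = 0\<^sub>v r"
    using lin_depI[OF U] colsU bs Bi by auto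
  have "\<exists>v\<in>carrier_vec r. U *\<^sub>v v = x" if x: "x \<in> set (cols A)" for x
  proof -
    have "x \<in> span B"
    proof (cases "x \<in> B")
      case True then show ?thesis using span_mem Bc by blast
    next
      case False
      have "lin_dep (insert x B)"
      proof (rule ccontr)
        assume "lin_indpt (insert x B)"
        then have "insert x B = B" using B(2) Bs x unfolding maximal_def by blast
        then show False using False by blast
      qed
      then show ?thesis using lin_dep_iff_in_span[OF Bc Bi _ False] x sub by auto
    qed
    then obtain a where "x = lincomb a B"
      using finite_in_span[OF B(1) Bc] by blast
    then show ?thesis using mat_mult_eq_lincomb[OF U, of a] colsU bs by (auto intro!: bexI[of _ "vec r (\<lambda>i. a (col U i))"])
  qed
  then obtain c where c: "\<And>x. x \<in> set (cols A) \<Longrightarrow> c x \<in> carrier_vec r \<and> U *\<^sub>v c x = x"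
    by metis
  define V where "V = mat_of_cols r (map (\<lambda>j. c (col A j)) [0..<m])"
  have V: "V \<in> carrier_mat r m" unfolding V_def by auto
  have cA: "col A j \<in> set (cols A)" if "j < m" for j using that A by (auto simp: cols_def)
  have AUV: "A = U * V"
  proof (rule mat_col_eqI)
    fix j assume "j < dim_col (U * V)"
    then have j: "j < m" using V by auto
    have "col V j = c (col A j)" unfolding V_def using j c[OF cA[OF j]] by (simp add: col_mat_of_cols)
    then show "col A j = col (U * V) j" using j c[OF cA[OF j]] col_mult2[OF U V j] by simp
  qed (use A U V in auto)
  have "\<exists>j<m. col A j = bs ! i" if "i < r" for i
  proof -
    have "bs ! i \<in> set (cols A)" using that len bs Bs by auto
    then show ?thesis using A by (auto simp: cols_def)
  qed
  then obtain p where p: "\<And>i. i < r \<Longrightarrow> p i < m \<and> col A (p i) = bs ! i" by metis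
  define S where "S = mat_of_cols m (map (\<lambda>i. unit_vec m (p i) :: 'a vec) [0..<r])"
  have S: "S \<in> carrier_mat m r" unfolding S_def by auto
  have AS: "A * S = U"
  proof (rule mat_col_eqI)
    fix i assume "i < dim_col U"
    then have i: "i < r" using U by auto
    have "col S i = unit_vec m (p i)" unfolding S_def using i by (simp add: col_mat_of_cols)
    moreover have "A *\<^sub>v unit_vec m (p i) = col A (p i)" using A p[OF i]
      by (metis mat_mult_unit_vec)
    moreover have "col U i = bs ! i" using i colsU U by (metis cols_nth carrier_matD(2))
    ultimately show "col (A * S) i = col U i" using i p[OF i] by (simp add: col_mult2[OF A S])
  qed (use A U S in auto)
  have "U * (V * S) = (U * V) * S" by (rule assoc_mult_mat[OF U V S, symmetric])
  also have "\<dots> = U" using AS unfolding AUV .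
  also have "U = U * 1\<^sub>m r" by (rule right_mult_one_mat[OF U, symmetric])
  finally have UVS: "U * (V * S) = U * 1\<^sub>m r" .
  have VS: "V * S = 1\<^sub>m r"
    by (rule mat_left_cancel[OF U inj mult_carrier_mat[OF V S] one_carrier_mat UVS])
  show thesis
    by (rule that[OF U[unfolded r_def] V[unfolded r_def] S[unfolded r_def] AUV VS[unfolded r_def] inj[unfolded r_def]])
qed

text \<open>For an idempotent, \<open>U\<close> itself can take the place of the selection matrix
  \<open>S\<close>: \<open>E\<close> fixes \<open>U = E * S\<close>, so
  \<open>U * (V * U) = U\<close>, and \<open>U\<close> cancels.\<close>

lemma (in vec_space) rank_factorization_idempotent:
  assumes E: "E \<in> carrier_mat n n" and idem: "E * E = E"
  obtains U V where "U \<in> carrier_mat n (rank E)" "V \<in> carrier_mat (rank E) n"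
    "E = U * V" "V * U = 1\<^sub>m (rank E)"
    "\<forall>v\<in>carrier_vec (rank E). U *\<^sub>v v = 0\<^sub>v n \<longrightarrow> v = 0\<^sub>v (rank E)"
proof -
  obtain U V S where f: "U \<in> carrier_mat n (rank E)" "V \<in> carrier_mat (rank E) n" "S \<in> carrier_mat n (rank E)"
    "E = U * V" "V * S = 1\<^sub>m (rank E)" "\<forall>v\<in>carrier_vec (rank E). U *\<^sub>v v = 0\<^sub>v n \<longrightarrow> v = 0\<^sub>v (rank E)"
    by (rule rank_factorization[OF E]) (rule that; assumption)
  have ES: "E * S = U"
    unfolding f(4) using f(1,2,3,5) by (subst assoc_mult_mat) auto
  have "E * U = U"
    using assoc_mult_mat[OF E E f(3)] idem ES by simp
  then have UVU: "U * (V * U) = U"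
    unfolding f(4) using f(1,2) by (subst (asm) assoc_mult_mat) auto
  then have "U * (V * U) = U * 1\<^sub>m (rank E)" using f(1) by simp
  then have "V * U = 1\<^sub>m (rank E)"
    by (rule mat_left_cancel[OF f(1,6) mult_carrier_mat[OF f(2,1)] one_carrier_mat])
  then show thesis by (rule that[OF f(1,2,4) _ f(6)])
qed

text \<open>The hypothesis \<open>ker\<close> says that \<open>M\<close> and \<open>M * M\<close>
  have the same kernel. For \<open>M = U * V\<close> this makes the square matrix
  \<open>V * U\<close> injective, hence invertible. With \<open>D\<close> its inverse, the witness
  is \<open>W = U * (D * (D * V))\<close>, the group inverse of \<open>M\<close>.\<close>

lemma (in vec_space) group_inverse_exists:
  fixes M :: "'a mat"
  assumes M: "M \<in> carrier_mat n n"
    and ker: "\<And>v. v \<in> carrier_vec n \<Longrightarrow> M *\<^sub>v (M *\<^sub>v v) = 0\<^sub>v n \<Longrightarrow> M *\<^sub>v v = 0\<^sub>v n"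
  obtains W where "W \<in> carrier_mat n n" "W * (M * M) = M"
proof -
  obtain U V S where f: "U \<in> carrier_mat n (rank M)" "V \<in> carrier_mat (rank M) n" "S \<in> carrier_mat n (rank M)"
    "M = U * V" "V * S = 1\<^sub>m (rank M)" "\<forall>v\<in>carrier_vec (rank M). U *\<^sub>v v = 0\<^sub>v n \<longrightarrow> v = 0\<^sub>v (rank M)"
    by (rule rank_factorization[OF M]) (rule that; assumption)
  let ?r = "rank M"
  have VU: "V * U \<in> carrier_mat ?r ?r" using f(1,2) by auto
  have MS: "M * S = U"
    unfolding f(4) using f(1,2,3,5) by (subst assoc_mult_mat) auto
  have inj: "x = 0\<^sub>v ?r" if x: "x \<in> carrier_vec ?r" "(V * U) *\<^sub>v x = 0\<^sub>v ?r" for x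
  proof -
    have Sx: "S *\<^sub>v x \<in> carrier_vec n" using f(3) x by auto
    \<comment> \<open>\<open>U x\<close> is in the image of \<open>M\<close>, so \<open>ker\<close>
      can be applied to the preimage \<open>S x\<close>.\<close>
    have MSx: "M *\<^sub>v (S *\<^sub>v x) = U *\<^sub>v x"
      using MS M f(3) x by (metis assoc_mult_mat_vec)
    have "M *\<^sub>v (U *\<^sub>v x) = U *\<^sub>v ((V * U) *\<^sub>v x)"
      using f(1,2) x f(4) assoc_mult_mat_vec[OF f(1,2), of "U *\<^sub>v x"] assoc_mult_mat_vec[OF f(2,1) x(1)] by simp
    also have "\<dots> = 0\<^sub>v n" using f(1) x by auto
    finally have "U *\<^sub>v x = 0\<^sub>v n" using ker[OF Sx] MSx by simp
    then show ?thesis using f(6) x(1) by blast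
  qed
  then have "det (V * U) \<noteq> 0" using det_0_iff_vec_prod_zero_field[OF VU] by blast
  from det_non_zero_imp_unit[OF VU this] obtain D where D: "D \<in> carrier_mat ?r ?r" "D * (V * U) = 1\<^sub>m ?r"
    by (auto simp: Units_def ring_mat_def)
  have a: "D * (V * (U * X)) = X" if "X \<in> carrier_mat ?r n" for X
  proof -
    have "D * (V * (U * X)) = D * ((V * U) * X)"
      using assoc_mult_mat[OF f(2,1) that] by simp
    also have "\<dots> = (D * (V * U)) * X"
      using assoc_mult_mat[OF D(1) VU that] by simp
    finally have "D * (V * (U * X)) = (D * (V * U)) * X" .
    then show ?thesis using D that by simp
  qed
  \<comment> \<open>Since \<open>M * M = U * X\<close>, the product \<open>W * (M * M)\<close>
    contracts in two rounds: \<open>D * (V * (U * X)) = X\<close>, then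
    \<open>D * X = V\<close>.\<close>
  define X where "X = V * M"
  have X: "X \<in> carrier_mat ?r n" using f(2) M by (simp add: X_def)
  have DX: "D * X = V" unfolding X_def using a[OF f(2)] f(4) by simp
  have MM: "M * M = U * X"
    unfolding X_def using assoc_mult_mat[OF f(1,2) M] f(4) by simp
  have DV: "D * V \<in> carrier_mat ?r n" "D * (D * V) \<in> carrier_mat ?r n" using D f(2) by auto
  have "(U * (D * (D * V))) * (U * X) = U * ((D * (D * V)) * (U * X))"
    using f(1) X by (intro assoc_mult_mat[OF f(1) DV(2)]) auto
  also have "(D * (D * V)) * (U * X) = D * ((D * V) * (U * X))"
    using f(1) X by (intro assoc_mult_mat[OF D(1) DV(1)]) auto
  also have "(D * V) * (U * X) = D * (V * (U * X))"
    using f(1) X by (intro assoc_mult_mat[OF D(1) f(2)]) auto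
  finally have "(U * (D * (D * V))) * (M * M) = M"
    unfolding MM a[OF X] DX using f(4) by simp
  moreover have "U * (D * (D * V)) \<in> carrier_mat n n" using f(1) DV by auto
  ultimately show thesis using that by blast
qed

section \<open>Trace and rank of idempotent matrices\<close>

definition mat_trace :: "'a::comm_semiring_0 mat \<Rightarrow> 'a" where
  "mat_trace A = (\<Sum>i<dim_row A. A $$ (i, i))"

lemma mat_trace_comm:
  assumes A: "A \<in> carrier_mat n m" and B: "B \<in> carrier_mat m n"
  shows "mat_trace (A * B) = mat_trace (B * A)"
proof -
  have "mat_trace (A * B) = (\<Sum>i<n. \<Sum>j<m. A $$ (i, j) * B $$ (j, i))"
    using A B by (simp add: mat_trace_def scalar_prod_def atLeast0LessThan)
  also have "\<dots> = (\<Sum>j<m. \<Sum>i<n. B $$ (j, i) * A $$ (i, j))"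
    by (subst sum.swap) (simp add: mult.commute)
  also have "\<dots> = mat_trace (B * A)"
    using A B by (simp add: mat_trace_def scalar_prod_def atLeast0LessThan)
  finally show ?thesis .
qed

text \<open>The traces of \<open>U * V\<close> and \<open>V * U\<close> agree, and the latter is an
  identity matrix of size \<open>rank E\<close>. The trace is linear, so ranks of idempotents can be
  added through it.\<close>

lemma (in vec_space) mat_trace_idempotent:
  assumes E: "E \<in> carrier_mat n n" and idem: "E * E = E"
  shows "mat_trace E = of_nat (rank E)"
proof -
  obtain U V where f: "U \<in> carrier_mat n (rank E)" "V \<in> carrier_mat (rank E) n"
    "E = U * V" "V * U = 1\<^sub>m (rank E)" "\<forall>v\<in>carrier_vec (rank E). U *\<^sub>v v = 0\<^sub>v n \<longrightarrow> v = 0\<^sub>v (rank E)"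
    by (rule rank_factorization_idempotent[OF E idem]) (rule that; assumption)
  have "mat_trace E = mat_trace (V * U)" by (subst f(3)) (rule mat_trace_comm[OF f(1,2)])
  then show ?thesis unfolding f(4) by (simp add: mat_trace_def)
qed

text \<open>In a factorization through dimension 0 every entry is an empty sum.\<close>

lemma (in vec_space) idempotent_rank_0:
  assumes E: "E \<in> carrier_mat n n" and idem: "E * E = E" and "rank E = 0"
  shows "E = 0\<^sub>m n n"
proof -
  obtain U V where f: "U \<in> carrier_mat n (rank E)" "V \<in> carrier_mat (rank E) n"
    "E = U * V" "V * U = 1\<^sub>m (rank E)" "\<forall>v\<in>carrier_vec (rank E). U *\<^sub>v v = 0\<^sub>v n \<longrightarrow> v = 0\<^sub>v (rank E)"
    by (rule rank_factorization_idempotent[OF E idem]) (rule that; assumption)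
  show ?thesis
  proof (rule eq_matI)
    fix i j assume "i < dim_row (0\<^sub>m n n :: 'a mat)" "j < dim_col (0\<^sub>m n n :: 'a mat)"
    then have ij: "i < n" "j < n" by auto
    have "(U * V) $$ (i, j) = row U i \<bullet> col V j" using f(1,2) ij by (intro index_mult_mat) auto
    also have "\<dots> = 0" using f(2) assms(3) by (simp add: scalar_prod_def)
    finally show "E $$ (i, j) = 0\<^sub>m n n $$ (i, j)" using ij f(3) by simp
  qed (use E in auto)
qed

subsection \<open>Block diagonalization by orthogonal idempotents\<close>

definition hstack :: "'a mat \<Rightarrow> 'a mat \<Rightarrow> 'a mat" where
  "hstack A B = mat (dim_row A) (dim_col A + dim_col B)
     (\<lambda>(i, j). if j < dim_col A then A $$ (i, j) else B $$ (i, j - dim_col A))"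

definition vstack :: "'a mat \<Rightarrow> 'a mat \<Rightarrow> 'a mat" where
  "vstack A B = mat (dim_row A + dim_row B) (dim_col A)
     (\<lambda>(i, j). if i < dim_row A then A $$ (i, j) else B $$ (i - dim_row A, j))"

lemma col_hstack:
  assumes "A \<in> carrier_mat n p" "B \<in> carrier_mat n q" "j < p + q"
  shows "col (hstack A B) j = (if j < p then col A j else col B (j - p))"
  using assms by (intro eq_vecI) (auto simp: hstack_def)

lemma row_vstack:
  assumes "A \<in> carrier_mat p n" "B \<in> carrier_mat q n" "i < p + q"
  shows "row (vstack A B) i = (if i < p then row A i else row B (i - p))"
  using assms by (intro eq_vecI) (auto simp: vstack_def)

lemma hstack_carrier [intro]:
  "A \<in> carrier_mat n p \<Longrightarrow> B \<in> carrier_mat n q \<Longrightarrow> hstack A B \<in> carrier_mat n (p + q)"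
  by (auto simp: hstack_def)

lemma vstack_carrier [intro]:
  "A \<in> carrier_mat p n \<Longrightarrow> B \<in> carrier_mat q n \<Longrightarrow> vstack A B \<in> carrier_mat (p + q) n"
  by (auto simp: vstack_def)

lemma mult_hstack:
  assumes "M \<in> carrier_mat m n" "A \<in> carrier_mat n p" "B \<in> carrier_mat n q"
  shows "M * hstack A B = hstack (M * A) (M * B)" (is "?L = ?R")
proof (rule eq_matI)
  fix i j assume "i < dim_row ?R" "j < dim_col ?R"
  then have "i < m" "j < p + q" using assms by (auto simp: hstack_def)
  then show "?L $$ (i, j) = ?R $$ (i, j)"
    using assms hstack_carrier[OF assms(2,3)] by (auto simp: col_hstack hstack_def[of "M * A"])
qed (use assms in \<open>auto simp: hstack_def\<close>)

lemma vstack_mult: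
  assumes "M \<in> carrier_mat n m" "A \<in> carrier_mat p n" "B \<in> carrier_mat q n"
  shows "vstack A B * M = vstack (A * M) (B * M)" (is "?L = ?R")
proof (rule eq_matI)
  fix i j assume "i < dim_row ?R" "j < dim_col ?R"
  then have "i < p + q" "j < m" using assms by (auto simp: vstack_def)
  then show "?L $$ (i, j) = ?R $$ (i, j)"
    using assms vstack_carrier[OF assms(2,3)] by (auto simp: row_vstack vstack_def[of "A * M"])
qed (use assms in \<open>auto simp: vstack_def\<close>)

lemma vstack_mult_hstack:
  assumes "V \<in> carrier_mat r n" "Q \<in> carrier_mat m n" "U \<in> carrier_mat n r" "P \<in> carrier_mat n m"
  shows "vstack V Q * hstack U P = four_block_mat (V * U) (V * P) (Q * U) (Q * P)" (is "?L = ?R")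
proof (rule eq_matI)
  fix i j assume "i < dim_row ?R" "j < dim_col ?R"
  then have "i < r + m" "j < r + m" using assms by (auto)
  then show "?L $$ (i, j) = ?R $$ (i, j)"
    using assms vstack_carrier[OF assms(1,2)] hstack_carrier[OF assms(3,4)] by (auto simp: row_vstack col_hstack)
qed (use assms in \<open>auto simp: vstack_def hstack_def\<close>)

lemma vstack_zero: "vstack (0\<^sub>m p n) (0\<^sub>m q n) = 0\<^sub>m (p + q) n"
  by (auto simp: vstack_def intro!: eq_matI)

lemma hstack_zero: "hstack (0\<^sub>m n p) (0\<^sub>m n q) = 0\<^sub>m n (p + q)"
  by (auto simp: hstack_def intro!: eq_matI)

lemma four_block_mat_one: "four_block_mat (1\<^sub>m p) (0\<^sub>m p q) (0\<^sub>m q p) (1\<^sub>m q) = 1\<^sub>m (p + q)"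
  by (rule eq_matI) auto

text \<open>Induction on the list, adjoining one factorization at a time. A tail of a complete
  family is only orthogonal, so the statement concerns orthogonal families with rectangular
  \<open>P\<close>, \<open>Q\<close> and the one-sided \<open>Q * P = 1\<close>. The two
  annihilation clauses record that the rows of \<open>Q\<close> and the columns of \<open>P\<close>
  are absorbed by the idempotents of the list; they make the off-diagonal blocks vanish in the next
  step.\<close>

lemma (in vec_space) block_diagonalization:
  fixes E :: "'i \<Rightarrow> 'a mat"
  assumes "distinct is"
    and "\<And>l. l \<in> set is \<Longrightarrow> E l \<in> carrier_mat n n"
    and "\<And>l. l \<in> set is \<Longrightarrow> E l * E l = E l"
    and "\<And>l l'. l \<in> set is \<Longrightarrow> l' \<in> set is \<Longrightarrow> l \<noteq> l' \<Longrightarrow> E l * E l' = 0\<^sub>m n n"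
    and "m = (\<Sum>l\<leftarrow>is. rank (E l))"
  shows "\<exists>P Q. P \<in> carrier_mat n m \<and> Q \<in> carrier_mat m n \<and> Q * P = 1\<^sub>m m \<and>
    (\<forall>B\<in>carrier_mat n n. (\<forall>l\<in>set is. E l * B = 0\<^sub>m n n) \<longrightarrow> Q * B = 0\<^sub>m m n) \<and>
    (\<forall>B\<in>carrier_mat n n. (\<forall>l\<in>set is. B * E l = 0\<^sub>m n n) \<longrightarrow> B * P = 0\<^sub>m n m) \<and>
    (\<forall>A\<in>carrier_mat n n. (\<forall>l\<in>set is. A * E l = E l * A) \<longrightarrow>
       (\<exists>T. (\<forall>l\<in>set is. T l \<in> carrier_mat (rank (E l)) (rank (E l))) \<and> Q * A * P = diag_block_mat (map T is)))"
  using assms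
proof (induction "is" arbitrary: m)
  case Nil
  then show ?case
    by (intro exI[of _ "0\<^sub>m n 0"] exI[of _ "0\<^sub>m 0 n"]) (auto intro!: eq_matI)
next
  case (Cons a "is")
  define m' where "m' = (\<Sum>l\<leftarrow>is. rank (E l))"
  have m: "m = rank (E a) + m'" using Cons.prems(5) by (simp add: m'_def)
  obtain P Q where PQ: "P \<in> carrier_mat n m'" "Q \<in> carrier_mat m' n" "Q * P = 1\<^sub>m m'"
    and Q0: "\<forall>B\<in>carrier_mat n n. (\<forall>l\<in>set is. E l * B = 0\<^sub>m n n) \<longrightarrow> Q * B = 0\<^sub>m m' n"
    and P0: "\<forall>B\<in>carrier_mat n n. (\<forall>l\<in>set is. B * E l = 0\<^sub>m n n) \<longrightarrow> B * P = 0\<^sub>m n m'"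
    and T: "\<forall>A\<in>carrier_mat n n. (\<forall>l\<in>set is. A * E l = E l * A) \<longrightarrow>
       (\<exists>T. (\<forall>l\<in>set is. T l \<in> carrier_mat (rank (E l)) (rank (E l))) \<and> Q * A * P = diag_block_mat (map T is))"
    using Cons.IH[of m'] Cons.prems m'_def by (auto 0 4)
  have E: "E l \<in> carrier_mat n n" if "l \<in> insert a (set is)" for l using Cons.prems(2) that by auto
  have Ea: "E a \<in> carrier_mat n n" "E a * E a = E a" using Cons.prems by auto
  have a: "a \<notin> set is" using Cons.prems by auto
  have orth: "E l * E a = 0\<^sub>m n n" "E a * E l = 0\<^sub>m n n" if "l \<in> set is" for l
    using Cons.prems(4) that a by force+
  define r where "r = rank (E a)"
  obtain U V where f0: "U \<in> carrier_mat n (rank (E a))" "V \<in> carrier_mat (rank (E a)) n"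
    "E a = U * V" "V * U = 1\<^sub>m (rank (E a))"
    by (rule rank_factorization_idempotent[OF Ea])
  note f = f0[folded r_def]
  \<comment> \<open>\<open>E a\<close> can be inserted in front of \<open>U\<close> and behind
    \<open>V\<close> at will.\<close>
  have EU: "E a * U = U"
    unfolding f(3) assoc_mult_mat[OF f(1,2,1)] f(4) using f(1) by simp
  have VE: "V * E a = V"
    unfolding f(3) assoc_mult_mat[OF f(2,1,2), symmetric] f(4) using f(2) by simp
  \<comment> \<open>The off-diagonal blocks: insert \<open>E a\<close> next to \<open>U\<close> or
    \<open>V\<close>. As \<open>A\<close> commutes with the idempotents, every \<open>E l\<close> of
    the tail kills \<open>A * E a\<close> from the left and \<open>E a * A\<close> from the right,
    so the annihilation clauses for \<open>Q\<close> and \<open>P\<close> apply.\<close>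
  have QAU: "Q * A * U = 0\<^sub>m m' r" and VAP: "V * A * P = 0\<^sub>m r m'"
    if A: "A \<in> carrier_mat n n" and comm: "\<forall>l\<in>insert a (set is). A * E l = E l * A" for A
  proof -
    have "E l * (A * E a) = 0\<^sub>m n n" if l: "l \<in> set is" for l
      using comm assoc_mult_mat[OF E[of l] Ea(1) A] orth[OF l] A l by simp
    then have *: "Q * (A * E a) = 0\<^sub>m m' n" using Q0 A Ea(1) by auto
    have "Q * A * U = Q * (A * (E a * U))" using assoc_mult_mat[OF PQ(2) A f(1)] EU by simp
    also have "\<dots> = Q * (A * E a) * U"
      using assoc_mult_mat[OF A Ea(1) f(1)] assoc_mult_mat[OF PQ(2) mult_carrier_mat[OF A Ea(1)] f(1)] by simp
    finally show "Q * A * U = 0\<^sub>m m' r" using * f(1) by simp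
    have "(E a * A) * E l = 0\<^sub>m n n" if l: "l \<in> set is" for l
      using comm assoc_mult_mat[OF Ea(1) A E[of l]] assoc_mult_mat[OF Ea(1) E[of l] A] orth[OF l] A l by simp
    then have *: "(E a * A) * P = 0\<^sub>m n m'" using P0 A Ea(1) by auto
    have "V * A * P = (V * E a) * A * P" using VE by simp
    also have "\<dots> = V * ((E a * A) * P)"
      using assoc_mult_mat[OF f(2) Ea(1) A] assoc_mult_mat[OF f(2) mult_carrier_mat[OF Ea(1) A] PQ(1)] by simp
    finally show "V * A * P = 0\<^sub>m r m'" using * f(2) by simp
  qed
  let ?P = "hstack U P" and ?Q = "vstack V Q"
  have conj: "?Q * A * ?P = four_block_mat (V * A * U) (0\<^sub>m r m') (0\<^sub>m m' r) (Q * A * P)"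
    if A: "A \<in> carrier_mat n n" and comm: "\<forall>l\<in>insert a (set is). A * E l = E l * A" for A
    using vstack_mult[OF A f(2) PQ(2)]
      vstack_mult_hstack[OF mult_carrier_mat[OF f(2) A] mult_carrier_mat[OF PQ(2) A] f(1) PQ(1)]
      QAU[OF that] VAP[OF that] by simp
  have Qc: "?Q \<in> carrier_mat m n" and Pc: "?P \<in> carrier_mat n m"
    using f(1,2) PQ(1,2) unfolding m r_def[symmetric] by auto
  \<comment> \<open>The identity commutes with everything; \<open>conj\<close> for it is the claim
    \<open>?Q * ?P = 1\<close>.\<close>
  have one_c: "1\<^sub>m n \<in> carrier_mat n n" "\<forall>l\<in>insert a (set is). 1\<^sub>m n * E l = E l * 1\<^sub>m n"
    using E by (auto simp: left_mult_one_mat[of _ n n] right_mult_one_mat[of _ n n])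
  have "?Q * 1\<^sub>m n * ?P = four_block_mat (V * 1\<^sub>m n * U) (0\<^sub>m r m') (0\<^sub>m m' r) (Q * 1\<^sub>m n * P)"
    by (rule conj[OF one_c])
  then have "?Q * ?P = 1\<^sub>m m"
    unfolding right_mult_one_mat[OF Qc] right_mult_one_mat[OF f(2)] right_mult_one_mat[OF PQ(2)] f(4) PQ(3)
      four_block_mat_one m r_def[symmetric] .
  moreover have "?Q * B = 0\<^sub>m m n" if B: "B \<in> carrier_mat n n" "\<forall>l\<in>set (a # is). E l * B = 0\<^sub>m n n" for B
  proof -
    have "V * B = V * (E a * B)" using VE assoc_mult_mat[OF f(2) Ea(1) B(1)] by simp
    then have "V * B = 0\<^sub>m r n" using B f(2) by simp
    moreover have "Q * B = 0\<^sub>m m' n" using Q0 B by auto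
    ultimately show ?thesis using vstack_mult[OF B(1) f(2) PQ(2)] by (simp add: vstack_zero m r_def)
  qed
  moreover have "B * ?P = 0\<^sub>m n m" if B: "B \<in> carrier_mat n n" "\<forall>l\<in>set (a # is). B * E l = 0\<^sub>m n n" for B
  proof -
    have "B * U = (B * E a) * U" using EU assoc_mult_mat[OF B(1) Ea(1) f(1)] by simp
    then have "B * U = 0\<^sub>m n r" using B f(1) by simp
    moreover have "B * P = 0\<^sub>m n m'" using P0 B by auto
    ultimately show ?thesis using mult_hstack[OF B(1) f(1) PQ(1)] by (simp add: hstack_zero m r_def)
  qed
  moreover have "\<exists>T. (\<forall>l\<in>set (a # is). T l \<in> carrier_mat (rank (E l)) (rank (E l))) \<and>
      ?Q * A * ?P = diag_block_mat (map T (a # is))"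
    if A: "A \<in> carrier_mat n n" and comm: "\<forall>l\<in>set (a # is). A * E l = E l * A" for A
  proof -
    obtain T' where T': "\<forall>l\<in>set is. T' l \<in> carrier_mat (rank (E l)) (rank (E l))" "Q * A * P = diag_block_mat (map T' is)"
      using T A comm by auto
    \<comment> \<open>The update leaves the blocks of the tail alone because \<open>a\<close> does
      not occur there.\<close>
    define T where "T = T'(a := V * A * U)"
    define K where "K = V * A * U"
    define N where "N = Q * A * P"
    have Ta: "T a = K" by (simp add: T_def K_def)
    have "map T is = map T' is" using a by (auto simp: T_def)
    then have N: "diag_block_mat (map T is) = N" using T'(2) by (simp only: N_def)
    have "dim_row N = m'" "dim_col N = m'" "dim_row K = r" "dim_col K = r"
      using PQ f(1,2) by (auto simp: N_def K_def)
    then have "diag_block_mat (map T (a # is)) = four_block_mat K (0\<^sub>m r m') (0\<^sub>m m' r) N"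
      by (simp add: Let_def N Ta)
    then have "?Q * A * ?P = diag_block_mat (map T (a # is))"
      using conj[OF A] comm by (simp add: K_def N_def)
    moreover have "\<forall>l\<in>set (a # is). T l \<in> carrier_mat (rank (E l)) (rank (E l))"
      using T' f0(1,2) A by (auto simp: T_def)
    ultimately show ?thesis by blast
  qed
  ultimately show ?case using Pc Qc by blast
qed

section \<open>Normal matrices, and eigenvectors in the image of an idempotent\<close>

lemma scalar_prod_mult_adjoint:
  fixes M N :: "complex mat"
  assumes M: "M \<in> carrier_mat n n" and N: "N \<in> carrier_mat n n"
    and adj: "\<And>i j. i < n \<Longrightarrow> j < n \<Longrightarrow> N $$ (i, j) = cnj (M $$ (j, i))"
    and u: "u \<in> carrier_vec n" and v: "v \<in> carrier_vec n"
  shows "(M *\<^sub>v u) \<bullet>c v = u \<bullet>c (N *\<^sub>v v)"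
proof -
  have "(M *\<^sub>v u) \<bullet>c v = (\<Sum>i<n. \<Sum>j<n. M $$ (i, j) * u $ j * cnj (v $ i))"
    using M u v by (simp add: scalar_prod_def sum_distrib_right atLeast0LessThan)
  also have "\<dots> = (\<Sum>j<n. \<Sum>i<n. M $$ (i, j) * u $ j * cnj (v $ i))"
    by (rule sum.swap)
  also have "\<dots> = u \<bullet>c (N *\<^sub>v v)"
    using N u v adj by (simp add: scalar_prod_def sum_distrib_left atLeast0LessThan mult_ac)
  finally show ?thesis .
qed

text \<open>Put \<open>c = M v\<close>, so \<open>M c = 0\<close>. By normality
  \<open>M (N c) = N (M c) = 0\<close>; moving the adjoint across the scalar product,
  \<open>N c\<close> has norm zero, and then so has \<open>c\<close>, since its square norm is the
  product of \<open>v\<close> with \<open>N c\<close>.\<close>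

lemma normal_mat_kernel_square:
  fixes M N :: "complex mat"
  assumes M: "M \<in> carrier_mat n n" and N: "N \<in> carrier_mat n n"
    and adj: "\<And>i j. i < n \<Longrightarrow> j < n \<Longrightarrow> N $$ (i, j) = cnj (M $$ (j, i))"
    and normal: "M * N = N * M"
    and v: "v \<in> carrier_vec n" and sq: "M *\<^sub>v (M *\<^sub>v v) = 0\<^sub>v n"
  shows "M *\<^sub>v v = 0\<^sub>v n"
proof -
  define c where "c = M *\<^sub>v v"
  have c: "c \<in> carrier_vec n" using M v by (auto simp: c_def)
  have adj': "M $$ (i, j) = cnj (N $$ (j, i))" if "i < n" "j < n" for i j
    using adj[OF that(2,1)] by simp
  have Nc: "N *\<^sub>v c \<in> carrier_vec n" using N c by auto
  have "M *\<^sub>v (N *\<^sub>v c) = N *\<^sub>v (M *\<^sub>v c)"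
    using assoc_mult_mat_vec[OF M N c] assoc_mult_mat_vec[OF N M c] normal by simp
  also have "\<dots> = 0\<^sub>v n" using sq N by (auto simp: c_def intro!: eq_vecI)
  finally have MNc: "M *\<^sub>v (N *\<^sub>v c) = 0\<^sub>v n" .
  have "(N *\<^sub>v c) \<bullet>c (N *\<^sub>v c) = c \<bullet>c (M *\<^sub>v (N *\<^sub>v c))"
    by (rule scalar_prod_mult_adjoint[OF N M adj' c Nc])
  also have "\<dots> = 0" unfolding MNc using c by simp
  finally have "N *\<^sub>v c = 0\<^sub>v n" using conjugate_square_eq_0_vec[OF Nc] by simp
  moreover have "c \<bullet>c c = v \<bullet>c (N *\<^sub>v c)"
    using scalar_prod_mult_adjoint[OF M N adj v c] by (simp add: c_def)
  ultimately have "c \<bullet>c c = 0" using v by simp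
  then show ?thesis using conjugate_square_eq_0_vec[OF c] by (simp add: c_def)
qed

text \<open>\<open>K = V * M * U\<close> is the matrix of \<open>M\<close> restricted to the image
  of \<open>E\<close>, in the basis given by the columns of \<open>U\<close>. Its size is positive
  because \<open>E\<close> is nonzero, so it has a complex eigenvector, which \<open>U\<close>
  carries back to the image of \<open>E\<close>.\<close>

lemma eigenvector_in_idempotent_image:
  fixes E M :: "complex mat"
  assumes E: "E \<in> carrier_mat n n" and idem: "E * E = E" and nz: "E \<noteq> 0\<^sub>m n n"
    and M: "M \<in> carrier_mat n n" and comm: "M * E = E * M"
  obtains v c where "v \<in> carrier_vec n" "v \<noteq> 0\<^sub>v n" "E *\<^sub>v v = v" "M *\<^sub>v v = c \<cdot>\<^sub>v v"
proof -
  define r where "r = vec_space.rank n E"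
  obtain U V where f0: "U \<in> carrier_mat n (vec_space.rank n E)" "V \<in> carrier_mat (vec_space.rank n E) n"
    "E = U * V" "V * U = 1\<^sub>m (vec_space.rank n E)"
    "\<forall>v\<in>carrier_vec (vec_space.rank n E). U *\<^sub>v v = 0\<^sub>v n \<longrightarrow> v = 0\<^sub>v (vec_space.rank n E)"
    by (rule vec_space.rank_factorization_idempotent[OF E idem])
  note f = f0[folded r_def]
  have "r > 0" using vec_space.idempotent_rank_0[OF E idem] nz r_def by blast
  define K where "K = V * M * U"
  have K: "K \<in> carrier_mat r r" using f M by (auto simp: K_def)
  obtain c x where "eigenvector K x c"
    using spectrum_non_empty[OF K \<open>r > 0\<close>] by (auto simp: spectrum_def eigenvalue_def)
  then have x: "x \<in> carrier_vec r" "x \<noteq> 0\<^sub>v r" "K *\<^sub>v x = c \<cdot>\<^sub>v x" using K by (auto simp: eigenvector_def)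
  define v where "v = U *\<^sub>v x"
  have v: "v \<in> carrier_vec n" "v \<noteq> 0\<^sub>v n" using x f(1,5) by (auto simp: v_def)
  have "E * U = U"
    using assoc_mult_mat[OF f(1,2,1)] f(1,3,4) by simp
  then have Ev: "E *\<^sub>v v = v" unfolding v_def using assoc_mult_mat_vec[OF E f(1) x(1)] by simp
  have Mv: "M *\<^sub>v v \<in> carrier_vec n" using M v by auto
  have VMv: "V *\<^sub>v (M *\<^sub>v v) = c \<cdot>\<^sub>v x"
  proof -
    have "V *\<^sub>v (M *\<^sub>v v) = (V * M) *\<^sub>v v" by (rule assoc_mult_mat_vec[OF f(2) M v(1), symmetric])
    also have "\<dots> = K *\<^sub>v x" unfolding v_def K_def
      by (rule assoc_mult_mat_vec[OF mult_carrier_mat[OF f(2) M] f(1) x(1), symmetric])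
    finally show ?thesis using x(3) by simp
  qed
  \<comment> \<open>By commutation \<open>M v\<close> stays in the image of \<open>E\<close>, so it
    is recovered by \<open>U\<close> from its coordinates \<open>V (M v)\<close>.\<close>
  have "M *\<^sub>v v = M *\<^sub>v (E *\<^sub>v v)" using Ev by simp
  also have "\<dots> = E *\<^sub>v (M *\<^sub>v v)"
    using assoc_mult_mat_vec[OF M E v(1)] assoc_mult_mat_vec[OF E M v(1)] comm by simp
  also have "\<dots> = U *\<^sub>v (V *\<^sub>v (M *\<^sub>v v))"
    unfolding f(3) by (rule assoc_mult_mat_vec[OF f(1,2) Mv])
  also have "\<dots> = c \<cdot>\<^sub>v v" unfolding VMv using mult_mat_vec[OF f(1) x(1)] by (simp add: v_def)
  finally show thesis using that v Ev by blast
qed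

subsection \<open>Central idempotents\<close>

context ring
begin

lemma central_idempotents_closed: "e \<in> central_idempotents R \<Longrightarrow> e \<in> carrier R"
  by (simp add: central_idempotents_def)

lemma central_idempotents_idem: "e \<in> central_idempotents R \<Longrightarrow> e \<otimes> e = e"
  by (simp add: central_idempotents_def)

lemma central_idempotents_commute:
  "e \<in> central_idempotents R \<Longrightarrow> x \<in> carrier R \<Longrightarrow> e \<otimes> x = x \<otimes> e"
  by (simp add: central_idempotents_def)

lemma central_idempotentsI:
  assumes "e \<in> carrier R" "e \<otimes> e = e" "\<And>x. x \<in> carrier R \<Longrightarrow> e \<otimes> x = x \<otimes> e"
  shows "e \<in> central_idempotents R"
  unfolding central_idempotents_def using assms by blast

lemma left_commute_of_commute:
  assumes "x \<otimes> y = y \<otimes> x" "x \<in> carrier R" "y \<in> carrier R" "z \<in> carrier R"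
  shows "x \<otimes> (y \<otimes> z) = y \<otimes> (x \<otimes> z)"
  using assms by (simp flip: m_assoc)

lemma central_idempotents_mult:
  assumes e: "e \<in> central_idempotents R" and f: "f \<in> central_idempotents R"
  shows "e \<otimes> f \<in> central_idempotents R"
proof -
  note c = central_idempotents_closed[OF e] central_idempotents_closed[OF f]
  note lcomm = left_commute_of_commute[OF central_idempotents_commute]
  have "(e \<otimes> f) \<otimes> (e \<otimes> f) = e \<otimes> (f \<otimes> (e \<otimes> f))"
    using c by (simp add: m_assoc)
  also have "f \<otimes> (e \<otimes> f) = e \<otimes> (f \<otimes> f)" by (rule lcomm[OF f c(1) c(2) c(1) c(2)])
  also have "e \<otimes> (e \<otimes> (f \<otimes> f)) = (e \<otimes> e) \<otimes> (f \<otimes> f)"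
    using c by (simp add: m_assoc)
  finally have "(e \<otimes> f) \<otimes> (e \<otimes> f) = (e \<otimes> e) \<otimes> (f \<otimes> f)" .
  then have "(e \<otimes> f) \<otimes> (e \<otimes> f) = e \<otimes> f"
    using central_idempotents_idem[OF e] central_idempotents_idem[OF f] by simp
  moreover have "(e \<otimes> f) \<otimes> x = x \<otimes> (e \<otimes> f)" if x: "x \<in> carrier R" for x
  proof -
    have "(e \<otimes> f) \<otimes> x = e \<otimes> (x \<otimes> f)"
      using c x central_idempotents_commute[OF f x] by (simp add: m_assoc)
    also have "\<dots> = x \<otimes> (e \<otimes> f)" by (rule lcomm[OF e x c(1) x c(2)])
    finally show ?thesis .
  qed
  ultimately show ?thesis by (intro central_idempotentsI m_closed c)
qed

lemma central_idempotents_one: "\<one> \<in> central_idempotents R"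
  by (simp add: central_idempotents_def)

text \<open>The condition \<open>fe\<close> expresses that \<open>f\<close> lies below
  \<open>e\<close> in the order of idempotents; the difference is the complement of \<open>f\<close>
  inside \<open>e\<close>.\<close>

lemma central_idempotents_minus:
  assumes e: "e \<in> central_idempotents R" and f: "f \<in> central_idempotents R" and fe: "f \<otimes> e = f"
  shows "e \<ominus> f \<in> central_idempotents R" "f \<otimes> (e \<ominus> f) = \<zero>" "e = f \<oplus> (e \<ominus> f)"
proof -
  note c = central_idempotents_closed[OF e] central_idempotents_closed[OF f]
  have ef: "e \<otimes> f = f" using central_idempotents_commute[OF e c(2)] fe by simp
  show m: "f \<otimes> (e \<ominus> f) = \<zero>"
    using c fe central_idempotents_idem[OF f] by (simp add: minus_eq r_distr r_minus r_neg)
  have "e \<otimes> (e \<ominus> f) = e \<ominus> f"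
    using c ef central_idempotents_idem[OF e] by (simp add: minus_eq r_distr r_minus)
  then have "(e \<ominus> f) \<otimes> (e \<ominus> f) = e \<ominus> f"
    using c m by (simp add: minus_eq l_distr l_minus)
  moreover have "(e \<ominus> f) \<otimes> x = x \<otimes> (e \<ominus> f)" if "x \<in> carrier R" for x
    using c that central_idempotents_commute[OF e that] central_idempotents_commute[OF f that]
    by (simp add: minus_eq l_distr r_distr l_minus r_minus)
  ultimately show "e \<ominus> f \<in> central_idempotents R" by (intro central_idempotentsI minus_closed c)
  have "f \<oplus> (e \<ominus> f) = (f \<oplus> \<ominus> f) \<oplus> e" using c by (simp add: minus_eq a_ac)
  then show "e = f \<oplus> (e \<ominus> f)" using c by (simp add: r_neg)
qed

lemma primitive_central_idempotents_subset:
  "primitive_central_idempotents R \<subseteq> central_idempotents R"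
  by (auto simp: primitive_central_idempotents_def)

text \<open>Primitive central idempotents are atoms: otherwise \<open>f\<close> and its complement
  in \<open>e\<close> would split \<open>e\<close>.\<close>

lemma primitive_central_idempotent_below:
  assumes e: "e \<in> primitive_central_idempotents R" and f: "f \<in> central_idempotents R" and fe: "f \<otimes> e = f"
  shows "f = \<zero> \<or> f = e"
proof (rule ccontr)
  assume n: "\<not> (f = \<zero> \<or> f = e)"
  have e': "e \<in> central_idempotents R" using e primitive_central_idempotents_subset by blast
  note m = central_idempotents_minus[OF e' f fe]
  have "e \<ominus> f \<noteq> \<zero>"
    using n central_idempotents_closed[OF e'] central_idempotents_closed[OF f] by auto
  then show False using m n e f unfolding primitive_central_idempotents_def by blast
qed

text \<open>The product lies below both atoms; if nonzero, it would equal both.\<close>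

lemma primitive_central_idempotents_orthogonal:
  assumes e: "e \<in> primitive_central_idempotents R" and f: "f \<in> primitive_central_idempotents R"
    and "e \<noteq> f"
  shows "e \<otimes> f = \<zero>"
proof -
  have ci: "e \<in> central_idempotents R" "f \<in> central_idempotents R"
    using e f primitive_central_idempotents_subset by auto
  note c = ci[THEN central_idempotents_closed]
  have comm: "e \<otimes> f = f \<otimes> e" using central_idempotents_commute[OF ci(1) c(2)] .
  have "(e \<otimes> f) \<otimes> f = e \<otimes> f"
    using c central_idempotents_idem[OF ci(2)] by (simp add: m_assoc)
  moreover have "(f \<otimes> e) \<otimes> e = f \<otimes> e"
    using c central_idempotents_idem[OF ci(1)] by (simp add: m_assoc)
  ultimately have "(e \<otimes> f) \<otimes> f = e \<otimes> f" "(e \<otimes> f) \<otimes> e = e \<otimes> f"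
    unfolding comm by auto
  then show ?thesis
    using primitive_central_idempotent_below[OF e central_idempotents_mult[OF ci]]
      primitive_central_idempotent_below[OF f central_idempotents_mult[OF ci]] assms(3) by metis
qed

text \<open>By orthogonality the sum \<open>s\<close> satisfies \<open>p s = p\<close> for each atom
  \<open>p\<close>, so \<open>s\<close> is a central idempotent. If \<open>1 - s\<close> were
  nonzero, \<open>below\<close> would give an atom with
  \<open>p = p (1 - s) = p s (1 - s) = 0\<close>.\<close>

lemma finsum_primitive_central_idempotents:
  assumes fin: "finite (primitive_central_idempotents R)"
    and below: "\<And>f. f \<in> central_idempotents R \<Longrightarrow> f \<noteq> \<zero> \<Longrightarrow>
      \<exists>p\<in>primitive_central_idempotents R. p \<otimes> f = p"
  shows "(\<Oplus>e\<in>primitive_central_idempotents R. e) = \<one>"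
proof -
  let ?E = "primitive_central_idempotents R"
  define s where "s = (\<Oplus>e\<in>?E. e)"
  have Ec: "?E \<subseteq> carrier R" using primitive_central_idempotents_subset central_idempotents_closed by blast
  have s: "s \<in> carrier R" unfolding s_def using Ec by (intro finsum_closed) auto
  have ps: "p \<otimes> s = p" if p: "p \<in> ?E" for p
  proof -
    have "p \<otimes> s = (\<Oplus>e\<in>?E. p \<otimes> e)"
      unfolding s_def using fin Ec p by (intro finsum_rdistr) auto
    also have "\<dots> = (\<Oplus>e\<in>?E. if p = e then p else \<zero>)"
      using Ec p primitive_central_idempotents_orthogonal[OF p] central_idempotents_idem primitive_central_idempotents_subset
      by (intro add.finprod_cong') auto
    also have "\<dots> = p" using fin p Ec by (intro add.finprod_singleton[of _ _ "\<lambda>_. p"]) auto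
    finally show ?thesis .
  qed
  have "s \<otimes> s = (\<Oplus>e\<in>?E. e \<otimes> s)"
    unfolding s_def using fin Ec s[unfolded s_def] by (intro finsum_ldistr) auto
  also have "\<dots> = s" unfolding s_def[symmetric] using Ec ps by (subst (2) s_def, intro add.finprod_cong') auto
  finally have idem: "s \<otimes> s = s" .
  have "s \<otimes> x = x \<otimes> s" if x: "x \<in> carrier R" for x
  proof -
    have "s \<otimes> x = (\<Oplus>e\<in>?E. e \<otimes> x)"
      unfolding s_def using fin Ec x by (intro finsum_ldistr) auto
    also have "\<dots> = (\<Oplus>e\<in>?E. x \<otimes> e)"
      using Ec x primitive_central_idempotents_subset central_idempotents_commute
      by (intro add.finprod_cong') auto
    also have "\<dots> = x \<otimes> s"
      unfolding s_def using fin Ec x by (intro finsum_rdistr[symmetric]) auto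
    finally show ?thesis .
  qed
  then have sc: "s \<in> central_idempotents R" by (intro central_idempotentsI s idem)
  note m = central_idempotents_minus[OF central_idempotents_one sc r_one[OF s]]
  have "\<one> \<ominus> s = \<zero>"
  proof (rule ccontr)
    assume "\<one> \<ominus> s \<noteq> \<zero>"
    then obtain p where p: "p \<in> ?E" "p \<otimes> (\<one> \<ominus> s) = p" using below m(1) by blast
    have pc: "p \<in> carrier R" using p Ec by blast
    have "p \<otimes> (\<one> \<ominus> s) = (p \<otimes> s) \<otimes> (\<one> \<ominus> s)" using ps p(1) by simp
    also have "\<dots> = \<zero>" using m(2) pc s by (simp add: m_assoc)
    finally have "p = \<zero>" using p by simp
    then show False using p(1) by (simp add: primitive_central_idempotents_def)
  qed
  then show ?thesis using m(3) s by (simp add: s_def)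
qed

text \<open>If \<open>w\<close> inverts \<open>y\<close> on the ideal generated by \<open>y\<close>, then \<open>w \<otimes> y\<close> is the identity of that ideal.\<close>

lemma central_idempotent_of_group_inverse:
  assumes y: "y \<in> carrier R" "\<And>x. x \<in> carrier R \<Longrightarrow> y \<otimes> x = x \<otimes> y"
    and w: "w \<in> carrier R" "w \<otimes> (y \<otimes> y) = y"
  shows "w \<otimes> y \<in> central_idempotents R" "(w \<otimes> y) \<otimes> y = y"
proof -
  let ?f = "w \<otimes> y"
  have f: "?f \<in> carrier R" using y(1) w(1) by simp
  show fy: "?f \<otimes> y = y" using y(1) w by (simp add: m_assoc)
  have yf: "y \<otimes> ?f = y" using fy y(2)[OF f] by simp
  \<comment> \<open>Nothing is known about \<open>w\<close> commuting with \<open>x\<close>.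
    Centrality of \<open>f = w y\<close> comes from meeting in the middle: since \<open>y\<close> is
    central and \<open>y f = f y = y\<close>, both \<open>f x\<close> and \<open>x f\<close> equal
    \<open>f x f\<close>.\<close>
  have left: "?f \<otimes> x = (?f \<otimes> x) \<otimes> ?f" if x: "x \<in> carrier R" for x
  proof -
    have wxy: "(w \<otimes> x) \<otimes> y = ?f \<otimes> x" using y(2)[OF x] x y(1) w(1) by (simp add: m_assoc)
    have "?f \<otimes> x = (w \<otimes> x) \<otimes> (y \<otimes> ?f)" using wxy yf by simp
    also have "\<dots> = ((w \<otimes> x) \<otimes> y) \<otimes> ?f"
      using x y(1) w(1) f by (intro m_assoc[symmetric]) auto
    also note wxy
    finally show ?thesis .
  qed
  have right: "x \<otimes> ?f = (?f \<otimes> x) \<otimes> ?f" if x: "x \<in> carrier R" for x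
  proof -
    have xf: "y \<otimes> (x \<otimes> w) = x \<otimes> ?f"
      using left_commute_of_commute[OF y(2)[OF x] y(1) x w(1)] y(2)[OF w(1)] by simp
    have "x \<otimes> ?f = (?f \<otimes> y) \<otimes> (x \<otimes> w)" using xf fy by simp
    also have "\<dots> = ?f \<otimes> (y \<otimes> (x \<otimes> w))" using x y(1) w(1) f by (intro m_assoc) auto
    also note xf
    also have "?f \<otimes> (x \<otimes> ?f) = (?f \<otimes> x) \<otimes> ?f" using x f by (intro m_assoc[symmetric]) auto
    finally show ?thesis .
  qed
  have "?f \<otimes> ?f = w \<otimes> (y \<otimes> ?f)" using y(1) w(1) f by (intro m_assoc) auto
  then have "?f \<otimes> ?f = ?f" using yf by simp
  then show "?f \<in> central_idempotents R"
    by (rule central_idempotentsI[OF f]) (rule trans[OF left right[symmetric]])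
qed

end

subsection \<open>The complex group algebra\<close>

definition scale :: "complex \<Rightarrow> ('a \<Rightarrow> complex) \<Rightarrow> 'a \<Rightarrow> complex" where
  "scale c w = (\<lambda>x. c * w x)"

locale group_listing = group G for G (structure) +
  fixes n :: nat and g :: "nat \<Rightarrow> 'a"
  assumes fin: "finite (carrier G)" and bij: "bij_betw g {..<n} (carrier G)"
begin

abbreviation CG :: "('a \<Rightarrow> complex) ring" where "CG \<equiv> group_ring G"
abbreviation \<sigma> :: "('a \<Rightarrow> complex) \<Rightarrow> complex mat" where "\<sigma> \<equiv> group_ring_mat G n g"

sublocale CG: ring CG by (rule ring_group_ring[OF fin])

lemma carrier_CG_iff: "w \<in> carrier CG \<longleftrightarrow> (\<forall>x. x \<notin> carrier G \<longrightarrow> w x = 0)"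
  by (simp add: group_ring_def)

lemma CG_eqI:
  assumes "u \<in> carrier CG" "v \<in> carrier CG" "\<And>x. x \<in> carrier G \<Longrightarrow> u x = v x"
  shows "u = v"
proof
  fix x show "u x = v x" using assms unfolding carrier_CG_iff by (cases "x \<in> carrier G") auto
qed

lemma CG_add_apply: "(u \<oplus>\<^bsub>CG\<^esub> v) x = u x + v x"
  by (simp add: group_ring_def)

lemma CG_zero_eq: "\<zero>\<^bsub>CG\<^esub> = (\<lambda>x. 0)"
  by (simp add: group_ring_def)

lemma CG_one_apply: "\<one>\<^bsub>CG\<^esub> x = (if x = \<one> then 1 else 0)"
  by (simp add: group_ring_def)

lemma CG_minus_apply:
  assumes "u \<in> carrier CG" "v \<in> carrier CG"
  shows "(u \<ominus>\<^bsub>CG\<^esub> v) x = u x - v x"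
proof -
  have "(u \<ominus>\<^bsub>CG\<^esub> v) \<oplus>\<^bsub>CG\<^esub> v = u"
    using assms by (simp add: CG.minus_eq CG.a_assoc CG.l_neg)
  then have "(u \<ominus>\<^bsub>CG\<^esub> v) x + v x = u x" by (simp flip: CG_add_apply)
  then show ?thesis by (simp only: eq_diff_eq)
qed

lemma CG_finsum_apply:
  assumes "\<And>i. i \<in> I \<Longrightarrow> f i \<in> carrier CG" "finite I"
  shows "(\<Oplus>\<^bsub>CG\<^esub>i\<in>I. f i) x = (\<Sum>i\<in>I. f i x)"
  using assms(2,1)
  by (induction I rule: finite_induct) (simp_all add: CG_zero_eq CG_add_apply Pi_def)

lemma scale_closed: "w \<in> carrier CG \<Longrightarrow> scale c w \<in> carrier CG"
  by (simp add: carrier_CG_iff scale_def)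

lemma scale_mult_left: "scale c u \<otimes>\<^bsub>CG\<^esub> v = scale c (u \<otimes>\<^bsub>CG\<^esub> v)"
  by (auto simp: group_ring_def scale_def sum_distrib_left mult_ac case_prod_beta intro!: sum.cong)

lemma scale_mult_right: "u \<otimes>\<^bsub>CG\<^esub> scale c v = scale c (u \<otimes>\<^bsub>CG\<^esub> v)"
  by (auto simp: group_ring_def scale_def sum_distrib_left mult_ac case_prod_beta intro!: sum.cong)

lemma listing_closed [simp]: "i < n \<Longrightarrow> g i \<in> carrier G"
  using bij by (auto simp: bij_betw_def)

lemma listing_obtain:
  assumes "x \<in> carrier G" obtains i where "i < n" "g i = x"
  using assms bij unfolding bij_betw_def by (metis imageE lessThan_iff)

lemma sum_listing: "(\<Sum>x\<in>carrier G. f x) = (\<Sum>i<n. f (g i))"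
  by (rule sum.reindex_bij_betw[OF bij, symmetric])

lemma group_ring_mat_carrier [simp]: "\<sigma> w \<in> carrier_mat n n"
  by (simp add: group_ring_mat_def)

lemma group_ring_mat_index: "i < n \<Longrightarrow> j < n \<Longrightarrow> \<sigma> w $$ (i, j) = w (inv (g i) \<otimes> g j)"
  by (simp add: group_ring_mat_def)

lemma group_ring_mat_dim [simp]: "dim_row (\<sigma> w) = n" "dim_col (\<sigma> w) = n"
  by (simp_all add: group_ring_mat_def)

lemma sum_shift:
  assumes "a \<in> carrier G"
  shows "(\<Sum>y\<in>carrier G. f (a \<otimes> y)) = (\<Sum>y\<in>carrier G. f y)"
  by (rule sum.reindex_bij_witness[of _ "\<lambda>y. inv a \<otimes> y" "\<lambda>y. a \<otimes> y"])
     (use assms in \<open>simp_all flip: m_assoc\<close>)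

text \<open>Shifting the summation variable of the convolution by the inverse of \<open>g i\<close>
  turns its terms into products of an entry of row \<open>i\<close> and an entry of column
  \<open>j\<close>.\<close>

lemma group_ring_mat_mult: "\<sigma> (u \<otimes>\<^bsub>CG\<^esub> v) = \<sigma> u * \<sigma> v"
proof (rule eq_matI)
  fix i j assume "i < dim_row (\<sigma> u * \<sigma> v)" "j < dim_col (\<sigma> u * \<sigma> v)"
  then have ij: "i < n" "j < n" by auto
  note c = listing_closed[OF ij(1)] listing_closed[OF ij(2)]
  have cancel: "inv (inv (g i) \<otimes> z) \<otimes> (inv (g i) \<otimes> g j) = inv z \<otimes> g j" if "z \<in> carrier G" for z
    using that c by (simp add: inv_mult_group m_assoc) (simp flip: m_assoc)
  have "\<sigma> (u \<otimes>\<^bsub>CG\<^esub> v) $$ (i, j) = (\<Sum>y\<in>carrier G. u y * v (inv y \<otimes> (inv (g i) \<otimes> g j)))"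
    using ij c by (simp add: group_ring_mat_index group_ring_mult_eq[OF fin])
  also have "\<dots> = (\<Sum>z\<in>carrier G. u (inv (g i) \<otimes> z) * v (inv (inv (g i) \<otimes> z) \<otimes> (inv (g i) \<otimes> g j)))"
    by (rule sum_shift[symmetric, of _ "\<lambda>y. u y * v (inv y \<otimes> (inv (g i) \<otimes> g j))"]) (use c in simp)
  also have "\<dots> = (\<Sum>z\<in>carrier G. u (inv (g i) \<otimes> z) * v (inv z \<otimes> g j))"
    by (simp add: cancel)
  also have "\<dots> = (\<Sum>k<n. \<sigma> u $$ (i, k) * \<sigma> v $$ (k, j))"
    unfolding sum_listing using ij by (simp add: group_ring_mat_index)
  also have "\<dots> = (\<sigma> u * \<sigma> v) $$ (i, j)"
    using ij by (simp add: scalar_prod_def atLeast0LessThan)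
  finally show "\<sigma> (u \<otimes>\<^bsub>CG\<^esub> v) $$ (i, j) = (\<sigma> u * \<sigma> v) $$ (i, j)" .
qed auto

lemma group_ring_mat_row_one:
  assumes "i < n" "g i = \<one>" "j < n" shows "\<sigma> w $$ (i, j) = w (g j)"
  using assms by (simp add: group_ring_mat_index)

text \<open>The row belonging to the identity of the group lists all coefficients.\<close>

lemma group_ring_mat_inj:
  assumes "u \<in> carrier CG" "v \<in> carrier CG" "\<sigma> u = \<sigma> v"
  shows "u = v"
proof (rule CG_eqI[OF assms(1,2)])
  fix x assume "x \<in> carrier G"
  then obtain i j where "i < n" "g i = \<one>" "j < n" "g j = x"
    using listing_obtain one_closed by metis
  then show "u x = v x" using group_ring_mat_row_one assms(3) by metis
qed

lemma group_ring_mat_zero: "\<sigma> \<zero>\<^bsub>CG\<^esub> = 0\<^sub>m n n"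
  by (rule eq_matI) (auto simp: group_ring_mat_index CG_zero_eq)

lemma mat_trace_group_ring_mat: "mat_trace (\<sigma> w) = of_nat n * w \<one>"
  by (simp add: mat_trace_def group_ring_mat_index)

text \<open>The matrix of \<open>y\<close> is normal, since \<open>y\<close> commutes with the element whose matrix is the adjoint.\<close>

lemma group_ring_mat_central_kernel_square:
  assumes y: "y \<in> carrier CG" and central: "\<And>x. x \<in> carrier CG \<Longrightarrow> y \<otimes>\<^bsub>CG\<^esub> x = x \<otimes>\<^bsub>CG\<^esub> y"
    and v: "v \<in> carrier_vec n" "\<sigma> y *\<^sub>v (\<sigma> y *\<^sub>v v) = 0\<^sub>v n"
  shows "\<sigma> y *\<^sub>v v = 0\<^sub>v n"
proof -
  define y' where "y' x = (if x \<in> carrier G then cnj (y (inv x)) else 0)" for x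
  have "y' \<in> carrier CG" by (simp add: carrier_CG_iff y'_def)
  then have "\<sigma> y * \<sigma> y' = \<sigma> y' * \<sigma> y"
    using central by (simp flip: group_ring_mat_mult)
  moreover have "\<sigma> y' $$ (i, j) = cnj (\<sigma> y $$ (j, i))" if "i < n" "j < n" for i j
    using that by (simp add: group_ring_mat_index y'_def inv_mult_group)
  ultimately show ?thesis
    using normal_mat_kernel_square[of "\<sigma> y" n "\<sigma> y'" v] v by simp
qed

text \<open>The matrix \<open>W\<close> solving the equation need not be a group ring matrix. Only
  its row at the identity is kept, as the coefficients of \<open>w\<close>: that row of the matrix
  equation is already the equation in the group ring.\<close>

lemma central_group_inverse:
  assumes y: "y \<in> carrier CG" and central: "\<And>x. x \<in> carrier CG \<Longrightarrow> y \<otimes>\<^bsub>CG\<^esub> x = x \<otimes>\<^bsub>CG\<^esub> y"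
  obtains w where "w \<in> carrier CG" "w \<otimes>\<^bsub>CG\<^esub> (y \<otimes>\<^bsub>CG\<^esub> y) = y"
proof -
  obtain W where W: "W \<in> carrier_mat n n" "W * (\<sigma> y * \<sigma> y) = \<sigma> y"
    using vec_space.group_inverse_exists[OF group_ring_mat_carrier]
      group_ring_mat_central_kernel_square[OF y central] by metis
  obtain i where i: "i < n" "g i = \<one>" using listing_obtain one_closed by metis
  define w where "w x = (if x \<in> carrier G then W $$ (i, the_inv_into {..<n} g x) else 0)" for x
  have w: "w \<in> carrier CG" by (simp add: carrier_CG_iff w_def)
  have wg: "w (g k) = W $$ (i, k)" if "k < n" for k
    using that bij the_inv_into_f_f[of g "{..<n}" k] by (simp add: w_def bij_betw_def)
  have "w \<otimes>\<^bsub>CG\<^esub> (y \<otimes>\<^bsub>CG\<^esub> y) = y"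
  proof (rule CG_eqI)
    fix x assume x: "x \<in> carrier G"
    then obtain j where j: "j < n" "g j = x" using listing_obtain by metis
    have "(w \<otimes>\<^bsub>CG\<^esub> (y \<otimes>\<^bsub>CG\<^esub> y)) x = (\<Sum>k<n. w (g k) * \<sigma> (y \<otimes>\<^bsub>CG\<^esub> y) $$ (k, j))"
      unfolding group_ring_mult_eq[OF fin x] sum_listing
      using j by (simp add: group_ring_mat_index)
    also have "\<dots> = (\<Sum>k<n. W $$ (i, k) * (\<sigma> y * \<sigma> y) $$ (k, j))"
      by (intro sum.cong) (simp_all add: wg group_ring_mat_mult)
    also have "\<dots> = (W * (\<sigma> y * \<sigma> y)) $$ (i, j)"
      using W(1) i j by (simp add: scalar_prod_def atLeast0LessThan)
    also have "\<dots> = y x" unfolding W(2) using group_ring_mat_row_one[OF i j(1)] j(2) by simp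
    finally show "(w \<otimes>\<^bsub>CG\<^esub> (y \<otimes>\<^bsub>CG\<^esub> y)) x = y x" .
  qed (use w y in auto)
  then show thesis using that w by blast
qed

subsection \<open>Primitive central idempotents and conjugacy classes\<close>

lemma group_ring_mat_idem: "e \<otimes>\<^bsub>CG\<^esub> e = e \<Longrightarrow> \<sigma> e * \<sigma> e = \<sigma> e"
  by (simp flip: group_ring_mat_mult)

text \<open>Two evaluations of the trace: each diagonal entry of \<open>\<sigma> e\<close> is the
  coefficient at the identity. The right-hand side is additive in \<open>e\<close>.\<close>

lemma rank_idempotent:
  assumes "e \<otimes>\<^bsub>CG\<^esub> e = e"
  shows "of_nat (vec_space.rank n (\<sigma> e)) = of_nat n * e \<one>"
  using vec_space.mat_trace_idempotent[OF group_ring_mat_carrier group_ring_mat_idem[OF assms]]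
  by (simp add: mat_trace_group_ring_mat)

lemma rank_idempotent_pos:
  assumes "e \<in> carrier CG" "e \<otimes>\<^bsub>CG\<^esub> e = e" "e \<noteq> \<zero>\<^bsub>CG\<^esub>"
  shows "vec_space.rank n (\<sigma> e) > 0"
proof (rule ccontr)
  assume "\<not> vec_space.rank n (\<sigma> e) > 0"
  then have "\<sigma> e = \<sigma> \<zero>\<^bsub>CG\<^esub>"
    using vec_space.idempotent_rank_0[OF group_ring_mat_carrier group_ring_mat_idem[OF assms(2)]]
    by (simp add: group_ring_mat_zero)
  then show False using group_ring_mat_inj[OF assms(1) CG.zero_closed] assms(3) by blast
qed

lemma group_ring_mat_minus_scale_mult_vec:
  assumes "u \<in> carrier CG" "e \<in> carrier CG" and v: "v \<in> carrier_vec n"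
  shows "\<sigma> (u \<ominus>\<^bsub>CG\<^esub> scale c e) *\<^sub>v v = \<sigma> u *\<^sub>v v - c \<cdot>\<^sub>v (\<sigma> e *\<^sub>v v)"
proof (rule eq_vecI)
  fix i assume "i < dim_vec (\<sigma> u *\<^sub>v v - c \<cdot>\<^sub>v (\<sigma> e *\<^sub>v v))"
  then have "i < n" by simp
  have idx: "(u \<ominus>\<^bsub>CG\<^esub> scale c e) x = u x - c * e x" for x
    using CG_minus_apply[OF assms(1) scale_closed[OF assms(2)]] by (simp add: scale_def)
  show "(\<sigma> (u \<ominus>\<^bsub>CG\<^esub> scale c e) *\<^sub>v v) $ i = (\<sigma> u *\<^sub>v v - c \<cdot>\<^sub>v (\<sigma> e *\<^sub>v v)) $ i"
    using v \<open>i < n\<close>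
    by (simp add: scalar_prod_def group_ring_mat_index idx sum_distrib_left left_diff_distrib sum_subtractf mult.assoc)
qed auto

text \<open>An eigenvector of \<open>\<sigma> z\<close> in the image of \<open>\<sigma> e\<close> shows that \<open>y = z \<otimes> e - c e\<close> is not invertible in
  the ideal of \<open>e\<close>; so the identity of the ideal of \<open>y\<close> is a central idempotent properly below \<open>e\<close>,
  that is zero.\<close>

lemma primitive_central_idempotent_scalar:
  assumes e: "e \<in> primitive_central_idempotents CG"
    and z: "z \<in> carrier CG" and central: "\<And>x. x \<in> carrier CG \<Longrightarrow> z \<otimes>\<^bsub>CG\<^esub> x = x \<otimes>\<^bsub>CG\<^esub> z"
  obtains c where "z \<otimes>\<^bsub>CG\<^esub> e = scale c e"
proof -
  have ci: "e \<in> central_idempotents CG" and nz: "e \<noteq> \<zero>\<^bsub>CG\<^esub>"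
    using e by (auto simp: primitive_central_idempotents_def)
  note ec = CG.central_idempotents_closed[OF ci] and ee = CG.central_idempotents_idem[OF ci]
  have "\<sigma> e \<noteq> 0\<^sub>m n n"
    using group_ring_mat_inj[OF ec CG.zero_closed] nz by (auto simp: group_ring_mat_zero)
  moreover have "\<sigma> z * \<sigma> e = \<sigma> e * \<sigma> z"
    using central[OF ec] by (simp flip: group_ring_mat_mult)
  ultimately obtain v c where v: "v \<in> carrier_vec n" "v \<noteq> 0\<^sub>v n" "\<sigma> e *\<^sub>v v = v" "\<sigma> z *\<^sub>v v = c \<cdot>\<^sub>v v"
    using eigenvector_in_idempotent_image[OF group_ring_mat_carrier group_ring_mat_idem[OF ee] _ group_ring_mat_carrier]
    by metis
  define y where "y = z \<otimes>\<^bsub>CG\<^esub> e \<ominus>\<^bsub>CG\<^esub> scale c e"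
  have c: "z \<otimes>\<^bsub>CG\<^esub> e \<in> carrier CG" "scale c e \<in> carrier CG" "y \<in> carrier CG"
    using z ec scale_closed[OF ec] by (auto simp: y_def)
  have yv: "\<sigma> y *\<^sub>v v = 0\<^sub>v n"
    unfolding y_def group_ring_mat_minus_scale_mult_vec[OF c(1) ec v(1)] group_ring_mat_mult
    using v by (simp add: assoc_mult_mat_vec[of _ n n _ n])
  have y_central: "y \<otimes>\<^bsub>CG\<^esub> x = x \<otimes>\<^bsub>CG\<^esub> y" if x: "x \<in> carrier CG" for x
  proof -
    have "(z \<otimes>\<^bsub>CG\<^esub> e) \<otimes>\<^bsub>CG\<^esub> x = z \<otimes>\<^bsub>CG\<^esub> (x \<otimes>\<^bsub>CG\<^esub> e)"
      using z ec x CG.central_idempotents_commute[OF ci x] by (simp add: CG.m_assoc)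
    also have "\<dots> = x \<otimes>\<^bsub>CG\<^esub> (z \<otimes>\<^bsub>CG\<^esub> e)"
      by (rule CG.left_commute_of_commute[OF central[OF x] z x ec])
    finally have "(z \<otimes>\<^bsub>CG\<^esub> e) \<otimes>\<^bsub>CG\<^esub> x = x \<otimes>\<^bsub>CG\<^esub> (z \<otimes>\<^bsub>CG\<^esub> e)" .
    moreover have "scale c e \<otimes>\<^bsub>CG\<^esub> x = x \<otimes>\<^bsub>CG\<^esub> scale c e"
      using CG.central_idempotents_commute[OF ci x] by (simp add: scale_mult_left scale_mult_right)
    ultimately show ?thesis unfolding y_def CG.minus_eq
      using c(1,2) x by (simp add: CG.l_distr CG.r_distr CG.l_minus CG.r_minus)
  qed
  \<comment> \<open>\<open>y\<close> lies in the ideal of \<open>e\<close>; hence so does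
    \<open>w y\<close>, which places it below \<open>e\<close>.\<close>
  have ye: "y \<otimes>\<^bsub>CG\<^esub> e = y"
    unfolding y_def CG.minus_eq
    using c(1,2) ec z ee by (simp add: CG.l_distr CG.l_minus scale_mult_left CG.m_assoc)
  obtain w where w: "w \<in> carrier CG" "w \<otimes>\<^bsub>CG\<^esub> (y \<otimes>\<^bsub>CG\<^esub> y) = y"
    by (rule central_group_inverse[OF c(3) y_central])
  note f = CG.central_idempotent_of_group_inverse[OF c(3) y_central w]
  have "(w \<otimes>\<^bsub>CG\<^esub> y) \<otimes>\<^bsub>CG\<^esub> e = w \<otimes>\<^bsub>CG\<^esub> y"
    using w(1) c(3) ec ye by (simp add: CG.m_assoc)
  from CG.primitive_central_idempotent_below[OF e f(1) this]
  have "w \<otimes>\<^bsub>CG\<^esub> y = \<zero>\<^bsub>CG\<^esub>"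
  proof
    \<comment> \<open>Excluded, as \<open>\<sigma> e\<close> fixes the nonzero \<open>v\<close>
      while \<open>\<sigma> y\<close> kills it.\<close>
    assume "w \<otimes>\<^bsub>CG\<^esub> y = e"
    then have "\<sigma> e *\<^sub>v v = (\<sigma> w * \<sigma> y) *\<^sub>v v" by (simp flip: group_ring_mat_mult)
    also have "\<dots> = \<sigma> w *\<^sub>v (\<sigma> y *\<^sub>v v)"
      by (rule assoc_mult_mat_vec[OF group_ring_mat_carrier group_ring_mat_carrier v(1)])
    also have "\<dots> = 0\<^sub>v n" unfolding yv by (auto intro!: eq_vecI)
    finally show ?thesis using v(2,3) by simp
  qed
  then have "y = \<zero>\<^bsub>CG\<^esub>" using f(2) c(3) by simp
  then have "z \<otimes>\<^bsub>CG\<^esub> e = scale c e" using c(1,2) by (simp add: y_def)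
  then show thesis using that by blast
qed

text \<open>Induction on the rank of \<open>\<sigma> f\<close>. If \<open>f\<close> splits as
  \<open>a + b\<close>, the ranks add up and that of \<open>b\<close> is positive, so
  \<open>a\<close> has smaller rank; an atom below \<open>a\<close> is below
  \<open>f\<close>.\<close>

lemma primitive_central_idempotent_exists_below:
  assumes "f \<in> central_idempotents CG" "f \<noteq> \<zero>\<^bsub>CG\<^esub>"
  shows "\<exists>p\<in>primitive_central_idempotents CG. p \<otimes>\<^bsub>CG\<^esub> f = p"
  using assms
proof (induction "vec_space.rank n (\<sigma> f)" arbitrary: f rule: less_induct)
  case less
  note fc = CG.central_idempotents_closed[OF less(2)] and ff = CG.central_idempotents_idem[OF less(2)]
  show ?case
  proof (cases "f \<in> primitive_central_idempotents CG")
    case True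
    then show ?thesis using ff by blast
  next
    case False
    then obtain a b where ab: "a \<in> central_idempotents CG" "b \<in> central_idempotents CG"
      "a \<noteq> \<zero>\<^bsub>CG\<^esub>" "b \<noteq> \<zero>\<^bsub>CG\<^esub>" "a \<otimes>\<^bsub>CG\<^esub> b = \<zero>\<^bsub>CG\<^esub>" "f = a \<oplus>\<^bsub>CG\<^esub> b"
      using less(2,3) unfolding primitive_central_idempotents_def by blast
    note c = CG.central_idempotents_closed[OF ab(1)] CG.central_idempotents_closed[OF ab(2)]
    note i = CG.central_idempotents_idem[OF ab(1)] CG.central_idempotents_idem[OF ab(2)]
    have "(of_nat (vec_space.rank n (\<sigma> f)) :: complex)
        = of_nat (vec_space.rank n (\<sigma> a) + vec_space.rank n (\<sigma> b))"
      unfolding of_nat_add rank_idempotent[OF ff] rank_idempotent[OF i(1)] rank_idempotent[OF i(2)]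
      unfolding ab(6) CG_add_apply by (rule distrib_left)
    then have "vec_space.rank n (\<sigma> a) < vec_space.rank n (\<sigma> f)"
      using rank_idempotent_pos[OF c(2) i(2) ab(4)] unfolding of_nat_eq_iff by linarith
    then obtain p where p: "p \<in> primitive_central_idempotents CG" "p \<otimes>\<^bsub>CG\<^esub> a = p"
      using less(1)[OF _ ab(1,3)] by blast
    have pc: "p \<in> carrier CG"
      using p(1) CG.primitive_central_idempotents_subset CG.central_idempotents_closed by blast
    have "a \<otimes>\<^bsub>CG\<^esub> f = a" using c i ab(5,6) by (simp add: CG.r_distr)
    then have "p \<otimes>\<^bsub>CG\<^esub> f = p" using p(2) CG.m_assoc[OF pc c(1) fc] by simp
    then show ?thesis using p(1) by blast
  qed
qed

lemma complete_orthogonal_primitive_central_idempotents: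
  assumes "finite (primitive_central_idempotents CG)"
  shows "complete_orthogonal_idempotents CG (primitive_central_idempotents CG)"
  unfolding complete_orthogonal_idempotents_def
  using assms CG.primitive_central_idempotents_subset CG.central_idempotents_closed CG.central_idempotents_idem
    CG.primitive_central_idempotents_orthogonal
    CG.finsum_primitive_central_idempotents[OF assms primitive_central_idempotent_exists_below]
  by blast

section \<open>Class functions, conjugacy classes and class sums\<close>

definition \<delta> :: "'a \<Rightarrow> 'a \<Rightarrow> complex" where
  "\<delta> h = (\<lambda>x. if x = h then 1 else 0)"

text \<open>Test centrality against the group element \<open>h\<close>, embedded as
  \<open>\<delta> h\<close>, and compare coefficients at \<open>h \<otimes> x\<close>: one product
  has the value of \<open>z\<close> at the conjugate there, the other its value at
  \<open>x\<close>.\<close>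

lemma central_class_function:
  assumes z: "z \<in> carrier CG" and central: "\<And>x. x \<in> carrier CG \<Longrightarrow> z \<otimes>\<^bsub>CG\<^esub> x = x \<otimes>\<^bsub>CG\<^esub> z"
    and h: "h \<in> carrier G" "x \<in> carrier G"
  shows "z (h \<otimes> x \<otimes> inv h) = z x"
proof -
  have "\<delta> h \<in> carrier CG" using h by (auto simp: carrier_CG_iff \<delta>_def)
  note eq = fun_cong[OF central[OF this], of "h \<otimes> x"]
  have hx: "h \<otimes> x \<in> carrier G" using h by simp
  have "inv y \<otimes> (h \<otimes> x) = h \<longleftrightarrow> y = h \<otimes> x \<otimes> inv h" if "y \<in> carrier G" for y
    using that h by (metis inv_closed inv_solve_left inv_solve_right m_closed)
  then have "(z \<otimes>\<^bsub>CG\<^esub> \<delta> h) (h \<otimes> x) = (\<Sum>y\<in>carrier G. if y = h \<otimes> x \<otimes> inv h then z y else 0)"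
    unfolding group_ring_mult_eq[OF fin hx] by (intro sum.cong) (auto simp: \<delta>_def)
  also have "\<dots> = z (h \<otimes> x \<otimes> inv h)" using fin h by simp
  finally have l: "(z \<otimes>\<^bsub>CG\<^esub> \<delta> h) (h \<otimes> x) = z (h \<otimes> x \<otimes> inv h)" .
  have "(\<delta> h \<otimes>\<^bsub>CG\<^esub> z) (h \<otimes> x) = (\<Sum>y\<in>carrier G. if y = h then z (inv y \<otimes> (h \<otimes> x)) else 0)"
    unfolding group_ring_mult_eq[OF fin hx] by (intro sum.cong) (auto simp: \<delta>_def)
  also have "\<dots> = z (inv h \<otimes> (h \<otimes> x))" using fin h by simp
  also have "inv h \<otimes> (h \<otimes> x) = x" using h by (simp flip: m_assoc)
  finally show ?thesis using l eq by simp
qed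

text \<open>Replacing \<open>y\<close> by \<open>inv y \<otimes> x\<close> reverses the convolution
  up to a conjugation by \<open>inv x\<close> in the argument of \<open>z\<close>, which
  \<open>z\<close> does not see.\<close>

lemma class_function_central:
  assumes z: "\<And>h x. h \<in> carrier G \<Longrightarrow> x \<in> carrier G \<Longrightarrow> z (h \<otimes> x \<otimes> inv h) = z x"
  shows "z \<otimes>\<^bsub>CG\<^esub> u = u \<otimes>\<^bsub>CG\<^esub> z"
proof (rule CG_eqI)
  show "z \<otimes>\<^bsub>CG\<^esub> u \<in> carrier CG" "u \<otimes>\<^bsub>CG\<^esub> z \<in> carrier CG"
    using group_ring_mult_outside by (auto simp: carrier_CG_iff)
  fix x assume x: "x \<in> carrier G"
  have "(z \<otimes>\<^bsub>CG\<^esub> u) x = (\<Sum>y\<in>carrier G. z y * u (inv y \<otimes> x))"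
    by (rule group_ring_mult_eq[OF fin x])
  also have "\<dots> = (\<Sum>y\<in>carrier G. u y * z (inv y \<otimes> x))"
  proof (rule sum.reindex_bij_witness[of _ "\<lambda>y. x \<otimes> inv y" "\<lambda>y. inv y \<otimes> x"])
    fix y assume y: "y \<in> carrier G"
    show "x \<otimes> inv (inv y \<otimes> x) = y" "inv (x \<otimes> inv y) \<otimes> x = y"
      "inv y \<otimes> x \<in> carrier G" "x \<otimes> inv y \<in> carrier G"
      using x y by (simp_all add: inv_mult_group m_assoc) (simp add: m_assoc[symmetric])
    have "inv (inv y \<otimes> x) \<otimes> x = inv x \<otimes> y \<otimes> inv (inv x)"
      using x y by (simp add: inv_mult_group)
    then show "u (inv y \<otimes> x) * z (inv (inv y \<otimes> x) \<otimes> x) = z y * u (inv y \<otimes> x)"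
      using z[of "inv x" y] x y by simp
  qed
  also have "\<dots> = (u \<otimes>\<^bsub>CG\<^esub> z) x"
    by (rule group_ring_mult_eq[OF fin x, symmetric])
  finally show "(z \<otimes>\<^bsub>CG\<^esub> u) x = (u \<otimes>\<^bsub>CG\<^esub> z) x" .
qed

lemma conjugacy_classes_partition: "partition (carrier G) (conjugacy_classes G)"
  unfolding conjugacy_classes_def by (rule group_action.orbit_partition[OF action_by_conjugation])

lemma conjugacy_class_eq:
  assumes "C \<in> conjugacy_classes G"
  obtains x where "x \<in> carrier G" "C = {h \<otimes> x \<otimes> inv h | h. h \<in> carrier G}"
  using assms by (auto simp: conjugacy_classes_def orbits_def orbit_def)

lemma conjugacy_class_closed:
  assumes C: "C \<in> conjugacy_classes G" and x: "x \<in> carrier G" and h: "h \<in> carrier G"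
  shows "h \<otimes> x \<otimes> inv h \<in> C \<longleftrightarrow> x \<in> C"
proof -
  obtain a where a: "a \<in> carrier G" "C = {h \<otimes> a \<otimes> inv h | h. h \<in> carrier G}"
    by (rule conjugacy_class_eq[OF C])
  have closed: "h \<otimes> x \<otimes> inv h \<in> C" if "x \<in> C" and h: "h \<in> carrier G" for x h
  proof -
    obtain k where k: "k \<in> carrier G" "x = k \<otimes> a \<otimes> inv k" using \<open>x \<in> C\<close> a(2) by blast
    have "h \<otimes> x \<otimes> inv h = (h \<otimes> k) \<otimes> a \<otimes> inv (h \<otimes> k)"
      using h k a(1) by (simp add: inv_mult_group m_assoc)
    then show ?thesis using a(2) h k(1) by blast
  qed
  have "inv h \<otimes> (h \<otimes> x \<otimes> inv h) \<otimes> inv (inv h) = x"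
    using x h by (simp add: m_assoc) (simp flip: m_assoc)
  then show ?thesis using closed[of x h] closed[of "h \<otimes> x \<otimes> inv h" "inv h"] h by auto
qed

lemma central_constant_on_class:
  assumes z: "z \<in> carrier CG" "\<And>x. x \<in> carrier CG \<Longrightarrow> z \<otimes>\<^bsub>CG\<^esub> x = x \<otimes>\<^bsub>CG\<^esub> z"
    and C: "C \<in> conjugacy_classes G" "x \<in> C" "y \<in> C"
  shows "z x = z y"
proof -
  obtain a where a: "a \<in> carrier G" "C = {h \<otimes> a \<otimes> inv h | h. h \<in> carrier G}"
    by (rule conjugacy_class_eq[OF C(1)])
  have "z x = z a" if "x \<in> C" for x
    using that a central_class_function[OF z _ a(1)] by auto
  then show ?thesis using C by metis
qed

definition class_sum :: "'a set \<Rightarrow> 'a \<Rightarrow> complex" where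
  "class_sum C = (\<lambda>x. if x \<in> C then 1 else 0)"

lemma class_subset: "C \<in> conjugacy_classes G \<Longrightarrow> C \<subseteq> carrier G"
  using partition.partition_coverture[OF conjugacy_classes_partition] by blast

lemma class_sum_closed: "C \<in> conjugacy_classes G \<Longrightarrow> class_sum C \<in> carrier CG"
  using class_subset by (auto simp: carrier_CG_iff class_sum_def)

lemma class_sum_central:
  assumes "C \<in> conjugacy_classes G"
  shows "class_sum C \<otimes>\<^bsub>CG\<^esub> u = u \<otimes>\<^bsub>CG\<^esub> class_sum C"
  by (rule class_function_central) (simp add: class_sum_def conjugacy_class_closed[OF assms])

lemma finite_conjugacy_classes: "finite (conjugacy_classes G)"
  by (rule finite_subset[of _ "Pow (carrier G)"]) (use class_subset fin in auto)

lemma conjugacy_class_nonempty: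
  assumes "C \<in> conjugacy_classes G" shows "C \<noteq> {}"
  by (rule conjugacy_class_eq[OF assms]) (use one_closed in blast)

text \<open>The classes partition the group, so at \<open>x\<close> only the summand of its own
  class survives; \<open>z\<close> is constant on that class, whatever representative
  \<open>rep\<close> picks.\<close>

lemma central_eq_sum_class_sums:
  assumes z: "z \<in> carrier CG" "\<And>x. x \<in> carrier CG \<Longrightarrow> z \<otimes>\<^bsub>CG\<^esub> x = x \<otimes>\<^bsub>CG\<^esub> z"
    and rep: "\<And>C. C \<in> conjugacy_classes G \<Longrightarrow> rep C \<in> C"
  shows "z = (\<Oplus>\<^bsub>CG\<^esub>C\<in>conjugacy_classes G. scale (z (rep C)) (class_sum C))"
proof (rule CG_eqI)
  let ?S = "\<Oplus>\<^bsub>CG\<^esub>C\<in>conjugacy_classes G. scale (z (rep C)) (class_sum C)"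
  have cl: "scale (z (rep C)) (class_sum C) \<in> carrier CG" if "C \<in> conjugacy_classes G" for C
    using that by (intro scale_closed class_sum_closed)
  show "?S \<in> carrier CG" using cl by (intro CG.finsum_closed) auto
  fix x assume x: "x \<in> carrier G"
  then obtain D where D: "D \<in> conjugacy_classes G" "x \<in> D"
    using partition.partition_coverture[OF conjugacy_classes_partition] by blast
  have uniq: "C = D" if "C \<in> conjugacy_classes G" "x \<in> C" for C
    using partition.disjoint_union[OF conjugacy_classes_partition that(1) D(1)] that(2) D(2) by blast
  have "?S x = (\<Sum>C\<in>conjugacy_classes G. scale (z (rep C)) (class_sum C) x)"
    by (rule CG_finsum_apply[OF cl finite_conjugacy_classes])
  also have "\<dots> = (\<Sum>C\<in>conjugacy_classes G. if C = D then z (rep D) else 0)"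
  proof (rule sum.cong[OF refl])
    fix C assume C: "C \<in> conjugacy_classes G"
    show "scale (z (rep C)) (class_sum C) x = (if C = D then z (rep D) else 0)"
    proof (cases "x \<in> C")
      case True
      then show ?thesis using uniq[OF C True] by (simp add: scale_def class_sum_def)
    next
      case False
      then show ?thesis using D(2) by (auto simp: scale_def class_sum_def)
    qed
  qed
  also have "\<dots> = z (rep D)" using D(1) finite_conjugacy_classes by simp
  also have "\<dots> = z x" by (rule central_constant_on_class[OF z D(1) rep[OF D(1)] D(2)])
  finally show "z x = ?S x" by simp
qed (rule z)

text \<open>The primitive central idempotents and the class sums are two bases of the centre: the change of
  basis matrices \<open>M\<close>, \<open>N\<close> between them satisfy \<open>M N = 1\<close> and \<open>N M = 1\<close>, and the traces of these
  products are the two cardinalities.\<close>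

lemma card_primitive_central_idempotents:
  assumes finE: "finite (primitive_central_idempotents CG)"
  shows "card (primitive_central_idempotents CG) = card (conjugacy_classes G)"
proof -
  let ?E = "primitive_central_idempotents CG" and ?K = "conjugacy_classes G"
  have Ec: "e \<in> central_idempotents CG" if "e \<in> ?E" for e
    using that CG.primitive_central_idempotents_subset by blast
  have Ecc: "e \<in> carrier CG" if "e \<in> ?E" for e
    using Ec[OF that] by (rule CG.central_idempotents_closed)
  define rep where "rep C = (SOME x. x \<in> C)" for C :: "'a set"
  have rep: "rep C \<in> C" if "C \<in> ?K" for C
    unfolding rep_def some_in_eq by (rule conjugacy_class_nonempty[OF that])
  \<comment> \<open>The scalar by which the class sum of \<open>C\<close> acts on the ideal of
    \<open>e\<close>. The two matrices have entries \<open>e (rep C)\<close> and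
    \<open>l e C\<close>; \<open>row\<close> and \<open>col\<close> compute the diagonals of their
    two products.\<close>
  define l where "l e C = (SOME c. class_sum C \<otimes>\<^bsub>CG\<^esub> e = scale c e)" for e C
  have l: "class_sum C \<otimes>\<^bsub>CG\<^esub> e = scale (l e C) e" if e: "e \<in> ?E" and C: "C \<in> ?K" for e C
    unfolding l_def
    by (rule primitive_central_idempotent_scalar[OF e class_sum_closed[OF C] class_sum_central[OF C]]) (rule someI)
  \<comment> \<open>Expanding the left factor of \<open>e = e e\<close> in class sums gives
    \<open>e\<close> times this sum; compare at a point where \<open>e\<close> does not
    vanish.\<close>
  have row: "(\<Sum>C\<in>?K. e (rep C) * l e C) = 1" if e: "e \<in> ?E" for e
  proof -
    have "e \<noteq> (\<lambda>x. 0)" using e by (auto simp: primitive_central_idempotents_def CG_zero_eq)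
    then obtain x where x: "e x \<noteq> 0" by blast
    have "e \<otimes>\<^bsub>CG\<^esub> e = (\<Oplus>\<^bsub>CG\<^esub>C\<in>?K. scale (e (rep C)) (class_sum C)) \<otimes>\<^bsub>CG\<^esub> e"
      using central_eq_sum_class_sums[OF Ecc[OF e] CG.central_idempotents_commute[OF Ec[OF e]] rep]
      by (rule arg_cong[where f = "\<lambda>u. u \<otimes>\<^bsub>CG\<^esub> e"])
    also have "\<dots> = (\<Oplus>\<^bsub>CG\<^esub>C\<in>?K. scale (e (rep C)) (class_sum C) \<otimes>\<^bsub>CG\<^esub> e)"
      using Ecc[OF e] scale_closed[OF class_sum_closed]
      by (intro CG.finsum_ldistr finite_conjugacy_classes) auto
    finally have "e x = (\<Oplus>\<^bsub>CG\<^esub>C\<in>?K. scale (e (rep C)) (class_sum C) \<otimes>\<^bsub>CG\<^esub> e) x"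
      using CG.central_idempotents_idem[OF Ec[OF e]] by simp
    also have "\<dots> = (\<Sum>C\<in>?K. (scale (e (rep C)) (class_sum C) \<otimes>\<^bsub>CG\<^esub> e) x)"
      using Ecc[OF e] scale_closed[OF class_sum_closed]
      by (intro CG_finsum_apply finite_conjugacy_classes) auto
    also have "\<dots> = (\<Sum>C\<in>?K. e (rep C) * l e C) * e x"
      unfolding sum_distrib_right
      by (intro sum.cong) (simp_all add: scale_mult_left l[OF e], simp add: scale_def)
    finally show ?thesis using x by simp
  qed
  \<comment> \<open>Multiply the class sum by \<open>1\<close>, written as the sum of the primitive
    central idempotents, and evaluate at \<open>rep C\<close>, where the class sum is 1.\<close>
  have col: "(\<Sum>e\<in>?E. e (rep C) * l e C) = 1" if C: "C \<in> ?K" for C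
  proof -
    have kc: "class_sum C \<in> carrier CG" by (rule class_sum_closed[OF C])
    have sum_one: "(\<Oplus>\<^bsub>CG\<^esub>e\<in>?E. e) = \<one>\<^bsub>CG\<^esub>"
      using complete_orthogonal_primitive_central_idempotents[OF finE]
      by (simp add: complete_orthogonal_idempotents_def)
    have "class_sum C = class_sum C \<otimes>\<^bsub>CG\<^esub> (\<Oplus>\<^bsub>CG\<^esub>e\<in>?E. e)"
      unfolding sum_one using kc by simp
    also have "\<dots> = (\<Oplus>\<^bsub>CG\<^esub>e\<in>?E. class_sum C \<otimes>\<^bsub>CG\<^esub> e)"
      using Ecc kc by (intro CG.finsum_rdistr finE) auto
    finally have "class_sum C (rep C) = (\<Oplus>\<^bsub>CG\<^esub>e\<in>?E. class_sum C \<otimes>\<^bsub>CG\<^esub> e) (rep C)"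
      by (rule fun_cong)
    also have "\<dots> = (\<Sum>e\<in>?E. (class_sum C \<otimes>\<^bsub>CG\<^esub> e) (rep C))"
      using Ecc kc by (intro CG_finsum_apply finE) auto
    also have "\<dots> = (\<Sum>e\<in>?E. e (rep C) * l e C)"
      using C by (intro sum.cong) (simp_all add: l, simp add: scale_def mult.commute)
    finally show ?thesis using rep[OF C] by (simp add: class_sum_def)
  qed
  \<comment> \<open>One double sum counts both sets; \<open>of_nat\<close> into \<complex> is
    injective.\<close>
  have "(of_nat (card ?E) :: complex) = (\<Sum>e\<in>?E. \<Sum>C\<in>?K. e (rep C) * l e C)"
    using row by simp
  also have "\<dots> = (\<Sum>C\<in>?K. \<Sum>e\<in>?E. e (rep C) * l e C)" by (rule sum.swap)
  also have "\<dots> = of_nat (card ?K)" using col by simp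
  finally show ?thesis by (simp only: of_nat_eq_iff)
qed

section \<open>Block diagonalization of all group ring matrices at once\<close>

text \<open>\<open>P\<close> and \<open>Q\<close> are built from the matrices
  \<open>\<sigma> (e i)\<close> alone. They serve every \<open>\<sigma> w\<close>, since each
  \<open>e i\<close> is central and so \<open>\<sigma> w\<close> commutes with all of these.\<close>

lemma simultaneous_block_diagonalization:
  assumes e: "bij_betw e {..<k} (primitive_central_idempotents CG)"
    and r: "\<And>i. i < k \<Longrightarrow> r i = vec_space.rank n (\<sigma> (e i))"
  shows "\<exists>P Q. P \<in> carrier_mat n n \<and> Q \<in> carrier_mat n n \<and> inverts_mat P Q \<and> inverts_mat Q P \<and>
      (\<forall>A \<in> group_ring_matrices G n g. \<exists>T :: nat \<Rightarrow> complex mat.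
         (\<forall>i<k. T i \<in> carrier_mat (r i) (r i)) \<and> Q * A * P = diag_block_mat (map T [0..<k]))"
proof -
  let ?E = "primitive_central_idempotents CG"
  have finE: "finite ?E" using e bij_betw_finite by blast
  have eE: "e i \<in> ?E" if "i < k" for i using e that by (auto simp: bij_betw_def)
  have ci: "e i \<in> central_idempotents CG" if "i < k" for i
    using eE[OF that] CG.primitive_central_idempotents_subset by blast
  note idem = CG.central_idempotents_idem[OF ci]
  have orth: "\<sigma> (e i) * \<sigma> (e j) = 0\<^sub>m n n" if "i < k" "j < k" "i \<noteq> j" for i j
  proof -
    have "e i \<noteq> e j" using e that by (auto simp: bij_betw_def inj_on_def)
    then have "e i \<otimes>\<^bsub>CG\<^esub> e j = \<zero>\<^bsub>CG\<^esub>"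
      using CG.primitive_central_idempotents_orthogonal eE that by blast
    then show ?thesis by (simp add: group_ring_mat_zero flip: group_ring_mat_mult)
  qed
  \<comment> \<open>The ranks sum to \<open>n\<close>, which makes \<open>P\<close> and
    \<open>Q\<close> square: their sum is \<open>n\<close> times the coefficient at the identity of
    the sum of the idempotents, and that sum is \<open>1\<close>.\<close>
  have "(of_nat (\<Sum>l\<leftarrow>[0..<k]. vec_space.rank n (\<sigma> (e l))) :: complex) = (\<Sum>l<k. of_nat n * e l \<one>)"
    unfolding interv_sum_list_conv_sum_set_nat set_upt atLeast0LessThan of_nat_sum
    by (intro sum.cong) (simp_all add: rank_idempotent idem)
  also have "\<dots> = of_nat n * (\<Sum>f\<in>?E. f \<one>)"
    by (simp add: sum_distrib_left sum.reindex_bij_betw[OF e, of "\<lambda>f. of_nat n * f \<one>"])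
  also have "(\<Sum>f\<in>?E. f \<one>) = (\<Oplus>\<^bsub>CG\<^esub>f\<in>?E. f) \<one>"
    using CG.primitive_central_idempotents_subset CG.central_idempotents_closed finE
    by (intro CG_finsum_apply[symmetric]) auto
  also have "(\<Oplus>\<^bsub>CG\<^esub>f\<in>?E. f) = \<one>\<^bsub>CG\<^esub>"
    using complete_orthogonal_primitive_central_idempotents[OF finE]
    by (simp add: complete_orthogonal_idempotents_def)
  finally have n: "n = (\<Sum>l\<leftarrow>[0..<k]. vec_space.rank n (\<sigma> (e l)))"
    by (simp only: CG_one_apply simp_thms if_True mult_1_right of_nat_eq_iff)
  obtain P Q where PQ: "P \<in> carrier_mat n n" "Q \<in> carrier_mat n n" "Q * P = 1\<^sub>m n"
    and T: "\<forall>A\<in>carrier_mat n n. (\<forall>l\<in>set [0..<k]. A * \<sigma> (e l) = \<sigma> (e l) * A) \<longrightarrow>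
       (\<exists>T. (\<forall>l\<in>set [0..<k]. T l \<in> carrier_mat (vec_space.rank n (\<sigma> (e l))) (vec_space.rank n (\<sigma> (e l)))) \<and>
         Q * A * P = diag_block_mat (map T [0..<k]))"
    using vec_space.block_diagonalization[of "[0..<k]" "\<lambda>l. \<sigma> (e l)" n n] n orth group_ring_mat_idem[OF idem]
    by auto
  \<comment> \<open>For square matrices a one-sided inverse is two-sided.\<close>
  have "P * Q = 1\<^sub>m n" by (rule mat_mult_left_right_inverse[OF PQ(2,1,3)])
  then have inv: "inverts_mat P Q" "inverts_mat Q P" using PQ by (auto simp: inverts_mat_def)
  have "\<exists>T. (\<forall>i<k. T i \<in> carrier_mat (r i) (r i)) \<and> Q * A * P = diag_block_mat (map T [0..<k])"
    if A: "A \<in> group_ring_matrices G n g" for A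
  proof -
    obtain w where w: "w \<in> carrier CG" "A = \<sigma> w" using A by (auto simp: group_ring_matrices_def)
    have "A * \<sigma> (e l) = \<sigma> (e l) * A" if "l \<in> set [0..<k]" for l
      using CG.central_idempotents_commute[OF ci w(1), of l] that unfolding w(2)
      by (simp flip: group_ring_mat_mult)
    moreover have "A \<in> carrier_mat n n" by (simp add: w(2))
    ultimately obtain D where D: "\<forall>l\<in>set [0..<k]. D l \<in> carrier_mat (vec_space.rank n (\<sigma> (e l))) (vec_space.rank n (\<sigma> (e l)))"
      "Q * A * P = diag_block_mat (map D [0..<k])"
      using T by blast
    have "\<forall>i<k. D i \<in> carrier_mat (r i) (r i)" using D(1) r by simp
    then show ?thesis using D(2) by blast
  qed
  then show ?thesis using PQ inv by blast
qed

end

theorem theorem3p1: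
  fixes G :: "('a, 'b) monoid_scheme"
    and n k :: nat
    and g :: "nat \<Rightarrow> 'a"
    and e :: "nat \<Rightarrow> 'a \<Rightarrow> complex"
    and r :: "nat \<Rightarrow> nat"
  assumes "group G" and "finite (carrier G)" and "Coset.order G = n"
    and "bij_betw g {..<n} (carrier G)"
    and "bij_betw e {..<k} (primitive_central_idempotents (group_ring G))"
    and "\<And>i. i < k \<Longrightarrow> r i = vec_space.rank n (group_ring_mat G n g (e i))"
  shows "complete_orthogonal_idempotents (group_ring G) (e ` {..<k}) \<and>
    k = card (conjugacy_classes G) \<and>
    (\<exists>P Q. P \<in> carrier_mat n n \<and> Q \<in> carrier_mat n n \<and> inverts_mat P Q \<and> inverts_mat Q P \<and>
      (\<forall>A \<in> group_ring_matrices G n g.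
         \<exists>T :: nat \<Rightarrow> complex mat.
           (\<forall>i<k. T i \<in> carrier_mat (r i) (r i)) \<and>
           Q * A * P = diag_block_mat (map T [0..<k])))"
proof -
  interpret group_listing G n g
    using assms(1,2,4) by (simp add: group_listing_def group_listing_axioms_def)
  have img: "e ` {..<k} = primitive_central_idempotents CG"
    using assms(5) by (simp add: bij_betw_def)
  \<comment> \<open>Finiteness of the set is supplied by its enumeration \<open>e\<close>.\<close>
  then have finE: "finite (primitive_central_idempotents CG)" by (metis finite_imageI finite_lessThan)
  have "k = card (primitive_central_idempotents CG)"
    using bij_betw_same_card[OF assms(5)] by simp
  then show ?thesis
    using complete_orthogonal_primitive_central_idempotents[OF finE] card_primitive_central_idempotents[OF finE]
      simultaneous_block_diagonalization[OF assms(5,6)] unfolding img by blast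
qed

end
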